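(* Let $A\subset \mathbb{R}^2$ be a measurable set for which the large-distance graph $\mathcal{G}_A$ is $K_3$-free. Then $\lambda_2(A) \le 2\pi$ and $e(\mathcal{G}_A) \le \pi^2$. Moreover, each such set $A$ attaining the first bound (i.e. $\lambda_2(A)=2\pi$) is, up to changes on a set of $\lambda_2$-measure zero, a union of two non-overlapping unit balls. Each such set $A$ attaining the second bound (i.e. $e(\mathcal{G}_A)=\pi^2$) is, up to changes on a set of $\lambda_2$-measure zero, a disjoint union of two unit balls whose distance is larger than or equal to $2$.
   Context: $\lambda_m$ denotes $m$-dimensional Lebesgue measure and $\|\cdot\|$ is the Euclidean norm. A unit ball in $\mathbb{R}^2$ is a closed disk of radius $1$; two balls are non-overlapping if their interiors are disjoint. The distance between sets $A,B\subset\mathbb{R}^2$ is $\operatorname{dist}(A,B)=\inf\{\|a-b\| : a\in A,\ b\in B\}$. For a measurable set $A\subset\mathbb{R}^2$, the large-distance graph $\mathcal{G}_A$ has vertex set $A$ and edge set $\mathcal{E}_A=\{(p,q)\in A\times A : \|p-q\|>2\}$. Its "number of edges" is $e(\mathcal{G}_A):=\frac12\lambda_{4}(\mathcal{E}_A)$. The graph $\mathcal{G}_A$ is $K_3$-free if there are no three points of $A$ whose pairwise distances are all larger than $2$. *)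

theory Defs
  imports "HOL-Analysis.Analysis"
begin

definition large_distance_edges :: "(real^2) set \<Rightarrow> ((real^2) \<times> (real^2)) set" where
  "large_distance_edges A = {(p, q). p \<in> A \<and> q \<in> A \<and> norm (p - q) > 2}"

text \<open>
  The space \<open>(real^2) \<times> (real^2)\<close> carries the Euclidean product structure, so its
  \<^const>\<open>lebesgue\<close> measure is four-dimensional Lebesgue measure.  The count is
  extended-valued because \<open>A\<close> is not assumed to have finite measure.
\<close>
definition large_distance_edge_count :: "(real^2) set \<Rightarrow> ennreal" where
  "large_distance_edge_count A = (1 / 2) * emeasure lebesgue (large_distance_edges A)"

definition large_distance_K3_free :: "(real^2) set \<Rightarrow> bool" where
  "large_distance_K3_free A \<longleftrightarrow>
     \<not> (\<exists>p\<in>A. \<exists>q\<in>A. \<exists>r\<in>A. norm (p - q) > 2 \<and> norm (p - r) > 2 \<and> norm (q - r) > 2)"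

definition is_unit_ball :: "(real^2) set \<Rightarrow> bool" where
  "is_unit_ball B \<longleftrightarrow> (\<exists>c. B = cball c 1)"

definition non_overlapping :: "(real^2) set \<Rightarrow> (real^2) set \<Rightarrow> bool" where
  "non_overlapping B C \<longleftrightarrow> interior B \<inter> interior C = {}"

definition equal_up_to_null :: "(real^2) set \<Rightarrow> (real^2) set \<Rightarrow> bool" where
  "equal_up_to_null A B \<longleftrightarrow> sym_diff A B \<in> null_sets lebesgue"

end

theory Submission
  imports Defs
begin

text \<open>
  The bound on the edges follows from the bound on the area. The points of \<open>A\<close> at
  distance more than 2 from a given point of \<open>A\<close> are pairwise at distance at most 2,
  because there are no triangles; by the isodiametric inequality they have area at most
  \<open>pi\<close>. Integration over \<open>A\<close> bounds the measure of the edge set by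
  \<open>pi\<close> times the area of \<open>A\<close>. If this is \<open>2 * pi\<^sup>2\<close>,
  the area is \<open>2 * pi\<close>, hence \<open>A\<close> is essentially a union of two unit
  balls, and almost all pairs of points from different balls must be edges
  (\<open>emeasure_large_pairs_le\<close>, \<open>two_balls_edges_dist\<close>).

  For the area, \<open>A\<close> is replaced by its closure, which is compact and still has no
  triangles. Call two points far if their distance exceeds 2, and close otherwise. All estimates
  compare slices: two slices at abscissas \<open>x0 - t\<close> and \<open>x0 + t\<close>, the
  points of one being within \<open>r\<close> of those of the other, have total length at most
  \<open>2 * sqrt (r\<^sup>2 - 4 * t\<^sup>2)\<close>, just like two chords of a disc of diameter
  \<open>r\<close> (\<open>strip_area_le\<close>). For \<open>r\<close> equal to the diameter this
  is the isodiametric inequality. Let \<open>d\<close> be the diameter of the set, attained by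
  points \<open>p\<close> and \<open>q\<close> that are placed on the horizontal axis. The points
  far from \<open>p\<close> are pairwise close, so are the points far from \<open>q\<close>, and
  the remaining points lie in the lens of the discs of radius 2 around \<open>p\<close> and
  \<open>q\<close>.

  \<^item> If \<open>d\<^sup>2 < 8\<close>, the isodiametric inequality gives an area less than
    \<open>2 * pi\<close>.
  \<^item> If \<open>8 \<le> d\<^sup>2\<close> and \<open>d \<le> 157 / 50\<close>, elementary
    bounds for the slices inside and outside the lens suffice
    (\<open>moderate_diameter_area_less\<close>).
  \<^item> If \<open>157 / 50 < d < 4\<close>, the set is cut into two parts. It need not be a
    union of two sets of diameter at most 2: five points may form a cycle of far pairs. But the
    slice argument for a part of width 2 only uses pairs of points whose distances from the outer
    end of the part add up to little more than 2. A lens point can violate this for at most one of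
    the two parts, since violations for both would produce a triangle, so it can be put into the
    other part (\<open>left_part_near\<close>, \<open>right_part_near\<close>). So each part has
    area at most \<open>pi\<close>. Both areas cannot be \<open>pi\<close>, as the tips of the
    lens would then force the existence of further points that are incompatible with slices of
    full length (\<open>wide_area_less\<close>).
  \<^item> If \<open>4 \<le> d\<close>, the lens is at most a point, and the set is essentially a
    union of two sets of diameter at most 2, each of area at most \<open>pi\<close>
    (\<open>triangle_free_area_far\<close>).

  Hence equality occurs only in the last case, and there both sets have area \<open>pi\<close>. By
  the equality case of the isodiametric inequality both are unit balls up to null sets
  (\<open>isodiametric_unit_equality\<close>), and they do not overlap because the area of their
  union is \<open>2 * pi\<close>.
\<close>


section \<open>Areas by slices\<close>

definition slice :: "(real \<times> real) set \<Rightarrow> real \<Rightarrow> real set" where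
  "slice X x = {y. (x, y) \<in> X}"

definition len :: "(real \<times> real) set \<Rightarrow> real \<Rightarrow> real" where
  "len X x = measure lborel (slice X x)"

lemma slice_measurable [measurable]: "X \<in> sets borel \<Longrightarrow> slice X x \<in> sets borel"
proof -
  assume "X \<in> sets borel"
  then have "X \<in> sets (lborel \<Otimes>\<^sub>M lborel)" unfolding lborel_prod by simp
  then have "Pair x -` X \<in> sets lborel" by (rule sets_Pair1)
  then show ?thesis by (simp add: slice_def vimage_def)
qed

lemma slice_bounded:
  assumes "bounded X" shows "bounded (slice X x)"
proof -
  have "slice X x \<subseteq> snd ` X" by (force simp: slice_def)
  then show ?thesis using assms bounded_snd bounded_subset by blast
qed

lemma emeasure_slice:
  assumes "bounded X"
  shows "emeasure lborel (slice X x) = ennreal (len X x)"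
proof -
  have "emeasure lborel (slice X x) < \<infinity>"
    by (rule emeasure_bounded_finite[OF slice_bounded[OF assms]])
  then show ?thesis unfolding len_def by (simp add: emeasure_eq_ennreal_measure top.not_eq_extremum)
qed

lemma len_nonneg [simp]: "0 \<le> len X x"
  by (simp add: len_def)

lemma len_empty: "slice X x = {} \<Longrightarrow> len X x = 0"
  by (simp add: len_def)

lemma len_measurable [measurable]:
  assumes "X \<in> sets borel" shows "len X \<in> borel_measurable borel"
proof -
  have "X \<in> sets (lborel \<Otimes>\<^sub>M lborel)" using assms unfolding lborel_prod by simp
  then have "(\<lambda>x. emeasure lborel (Pair x -` X)) \<in> borel_measurable lborel"
    by (rule lborel.measurable_emeasure_Pair)
  then have "(\<lambda>x. enn2real (emeasure lborel (Pair x -` X))) \<in> borel_measurable lborel"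
    by measurable
  then show ?thesis
    by (simp add: len_def[abs_def] measure_def slice_def[abs_def] vimage_def)
qed

lemma emeasure_eq_slices:
  assumes "X \<in> sets borel" "bounded X"
  shows "emeasure lborel X = (\<integral>\<^sup>+x. ennreal (len X x) \<partial>lborel)"
proof -
  have "X \<in> sets (lborel \<Otimes>\<^sub>M lborel)" using assms unfolding lborel_prod by simp
  then have "emeasure (lborel \<Otimes>\<^sub>M lborel) X = (\<integral>\<^sup>+x. emeasure lborel (Pair x -` X) \<partial>lborel)"
    by (rule lborel.emeasure_pair_measure_alt)
  then show ?thesis
    using assms(2) by (simp add: lborel_prod emeasure_slice[symmetric] slice_def vimage_def)
qed

text \<open>
  The plane is folded along the vertical line at abscissa \<open>x0\<close>. All area bounds below
  compare the total length of the two slices at \<open>x0 - t\<close> and \<open>x0 + t\<close>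
  with an explicit function of \<open>t\<close>.
\<close>
lemma emeasure_eq_folded_slices:
  assumes [measurable]: "X \<in> sets borel" and "bounded X"
  shows "emeasure lborel X =
    (\<integral>\<^sup>+t. indicator {0<..} t * ennreal (len X (x0 - t) + len X (x0 + t)) \<partial>lborel)"
proof -
  let ?e = "\<lambda>x. ennreal (len X x)"
  have [measurable]: "len X \<in> borel_measurable borel" by measurable
  have m: "?e \<in> borel_measurable borel" by measurable
  have "emeasure lborel X = (\<integral>\<^sup>+x. ?e x \<partial>lborel)"
    using assms by (rule emeasure_eq_slices)
  also have "\<dots> = (\<integral>\<^sup>+x. indicator {..<x0} x * ?e x + indicator {x0<..} x * ?e x \<partial>lborel)"
    by (intro nn_integral_cong_AE eventually_mono[OF AE_lborel_singleton[of x0]])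
       (auto simp: indicator_def)
  also have "\<dots> = (\<integral>\<^sup>+x. indicator {..<x0} x * ?e x \<partial>lborel) + (\<integral>\<^sup>+x. indicator {x0<..} x * ?e x \<partial>lborel)"
    by (rule nn_integral_add) measurable
  also have "(\<integral>\<^sup>+x. indicator {..<x0} x * ?e x \<partial>lborel)
      = (\<integral>\<^sup>+t. indicator {0<..} t * ?e (x0 - t) \<partial>lborel)"
    by (subst nn_integral_real_affine[where c="-1" and t=x0])
       (auto intro!: nn_integral_cong simp: indicator_def)
  also have "(\<integral>\<^sup>+x. indicator {x0<..} x * ?e x \<partial>lborel)
      = (\<integral>\<^sup>+t. indicator {0<..} t * ?e (x0 + t) \<partial>lborel)"
    by (subst nn_integral_real_affine[where c="1" and t=x0])
       (auto intro!: nn_integral_cong simp: indicator_def)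
  also have "(\<integral>\<^sup>+t. indicator {0<..} t * ?e (x0 - t) \<partial>lborel) + (\<integral>\<^sup>+t. indicator {0<..} t * ?e (x0 + t) \<partial>lborel)
     = (\<integral>\<^sup>+t. indicator {0<..} t * ?e (x0 - t) + indicator {0<..} t * ?e (x0 + t) \<partial>lborel)"
    by (rule nn_integral_add[symmetric]) measurable
  also have "\<dots> = (\<integral>\<^sup>+t. indicator {0<..} t * ennreal (len X (x0 - t) + len X (x0 + t)) \<partial>lborel)"
    by (intro nn_integral_cong) (simp add: ennreal_plus distrib_left)
  finally show ?thesis .
qed

lemma emeasure_disc:
  assumes "0 \<le> r"
  shows "emeasure lborel (cball (c :: real \<times> real) r) = ennreal (pi * r\<^sup>2)"
  using assms by (simp add: emeasure_cball unit_ball_vol_2 power2_eq_square)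

lemma dist_plane_le_iff:
  fixes z z' :: "real \<times> real"
  assumes "0 \<le> r"
  shows "dist z z' \<le> r \<longleftrightarrow> (fst z - fst z')\<^sup>2 + (snd z - snd z')\<^sup>2 \<le> r\<^sup>2"
proof -
  have "dist z z' = sqrt ((fst z - fst z')\<^sup>2 + (snd z - snd z')\<^sup>2)"
    by (simp add: dist_prod_def dist_real_def)
  moreover have "sqrt a \<le> r \<longleftrightarrow> a \<le> r\<^sup>2" for a
    using real_sqrt_le_iff[of a "r\<^sup>2"] assms by simp
  ultimately show ?thesis by simp
qed

lemma square_le_iff_sqrt:
  fixes y a :: real
  assumes "0 \<le> a"
  shows "y\<^sup>2 \<le> a \<longleftrightarrow> - sqrt a \<le> y \<and> y \<le> sqrt a"
proof -
  have "y\<^sup>2 \<le> a \<longleftrightarrow> \<bar>y\<bar> \<le> sqrt a"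
    using real_sqrt_le_iff[of "y\<^sup>2" a] by simp
  then show ?thesis by linarith
qed

text \<open>
  The integrand is the total length of the two chords at distance \<open>t\<close> from the centre
  of a disc of radius \<open>\<rho>\<close>, so the integral is the area of that disc and no
  antiderivative is needed.
\<close>
lemma half_chord_integral:
  assumes "0 \<le> \<rho>"
  shows "(\<integral>\<^sup>+t. indicator {0<..<\<rho>} t * ennreal (4 * sqrt (\<rho>\<^sup>2 - t\<^sup>2)) \<partial>lborel) = ennreal (pi * \<rho>\<^sup>2)"
proof -
  let ?B = "cball (0::real \<times> real) \<rho>"
  have mem: "(x, y) \<in> ?B \<longleftrightarrow> x\<^sup>2 + y\<^sup>2 \<le> \<rho>\<^sup>2" for x y
    using dist_plane_le_iff[OF assms, of 0 "(x, y)"] by simp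
  have len: "len ?B x = (if \<bar>x\<bar> \<le> \<rho> then 2 * sqrt (\<rho>\<^sup>2 - x\<^sup>2) else 0)" for x
  proof (cases "\<bar>x\<bar> \<le> \<rho>")
    case True
    then have nn: "0 \<le> \<rho>\<^sup>2 - x\<^sup>2"
      using abs_le_square_iff[of x \<rho>] assms by simp
    have "slice ?B x = {y. y\<^sup>2 \<le> \<rho>\<^sup>2 - x\<^sup>2}"
      unfolding slice_def mem by (simp add: algebra_simps)
    also have "\<dots> = {- sqrt (\<rho>\<^sup>2 - x\<^sup>2) .. sqrt (\<rho>\<^sup>2 - x\<^sup>2)}"
      unfolding square_le_iff_sqrt[OF nn] by auto
    finally show ?thesis using True nn by (simp add: len_def)
  next
    case False
    then have "\<rho>\<^sup>2 < x\<^sup>2"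
      using abs_le_square_iff[of x \<rho>] assms by simp
    then have "\<not> x\<^sup>2 + y\<^sup>2 \<le> \<rho>\<^sup>2" for y
      using zero_le_power2[of y] by linarith
    then have "slice ?B x = {}" unfolding slice_def mem by simp
    then show ?thesis using False by (simp add: len_empty)
  qed
  have "ennreal (pi * \<rho>\<^sup>2) = emeasure lborel ?B" using emeasure_disc[OF assms] by simp
  also have "\<dots> = (\<integral>\<^sup>+t. indicator {0<..} t * ennreal (len ?B (0 - t) + len ?B (0 + t)) \<partial>lborel)"
    by (rule emeasure_eq_folded_slices) auto
  also have "\<dots> = (\<integral>\<^sup>+t. indicator {0<..<\<rho>} t * ennreal (4 * sqrt (\<rho>\<^sup>2 - t\<^sup>2)) \<partial>lborel)"
    by (intro nn_integral_cong) (auto simp: len indicator_def not_less)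
  finally show ?thesis by simp
qed

lemma folded_slices_le:
  assumes [measurable]: "X \<in> sets borel" and "bounded X"
    and w: "\<And>z. z \<in> X \<Longrightarrow> \<bar>fst z - x0\<bar> \<le> \<rho>"
    and le: "AE t in lborel. 0 < t \<longrightarrow> t < \<rho> \<longrightarrow> len X (x0 - t) + len X (x0 + t) \<le> g t"
  shows "emeasure lborel X \<le> (\<integral>\<^sup>+t. indicator {0<..<\<rho>} t * ennreal (g t) \<partial>lborel)"
proof -
  have z: "len X (x0 - t) = 0 \<and> len X (x0 + t) = 0" if "t > \<rho>" "t > 0" for t
    using w[of "(x0 - t, _)"] w[of "(x0 + t, _)"] that
    by (auto intro!: len_empty simp: slice_def)
  show ?thesis
    unfolding emeasure_eq_folded_slices[OF assms(1,2), of x0]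
  proof (intro nn_integral_mono_AE)
    show "AE t in lborel. indicator {0<..} t * ennreal (len X (x0 - t) + len X (x0 + t))
        \<le> indicator {0<..<\<rho>} t * ennreal (g t)"
      using le AE_lborel_singleton[of \<rho>]
    proof eventually_elim
      case (elim t)
      then show ?case using z[of t] by (auto simp: indicator_def ennreal_leI simp del: ennreal_plus)
    qed
  qed
qed

text \<open>
  The comparison behind every bound of the form \<open>pi * \<rho>\<^sup>2\<close>: a set whose
  folded slices are no longer than those of a disc has at most the area of the disc.
\<close>
lemma strip_area_le:
  assumes "X \<in> sets borel" "bounded X" "0 \<le> \<rho>"
    and "\<And>z. z \<in> X \<Longrightarrow> \<bar>fst z - x0\<bar> \<le> \<rho>"
    and "AE t in lborel. 0 < t \<longrightarrow> t < \<rho> \<longrightarrow> len X (x0 - t) + len X (x0 + t) \<le> 4 * sqrt (\<rho>\<^sup>2 - t\<^sup>2)"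
  shows "emeasure lborel X \<le> ennreal (pi * \<rho>\<^sup>2)"
proof -
  have "emeasure lborel X \<le> (\<integral>\<^sup>+t. indicator {0<..<\<rho>} t * ennreal (4 * sqrt (\<rho>\<^sup>2 - t\<^sup>2)) \<partial>lborel)"
    by (rule folded_slices_le[OF assms(1,2,4,5)])
  then show ?thesis unfolding half_chord_integral[OF assms(3)] .
qed

text \<open>
  In the case of equality the comparison of slices is an equality for almost every
  \<open>t\<close>; all that is used of this is that such \<open>t\<close> occur in every
  interval.
\<close>
lemma strip_area_eq:
  assumes X [measurable]: "X \<in> sets borel" and bd: "bounded X" and "0 \<le> \<rho>"
    and w: "\<And>z. z \<in> X \<Longrightarrow> \<bar>fst z - x0\<bar> \<le> \<rho>"
    and le: "AE t in lborel. 0 < t \<longrightarrow> t < \<rho> \<longrightarrow> len X (x0 - t) + len X (x0 + t) \<le> 4 * sqrt (\<rho>\<^sup>2 - t\<^sup>2)"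
    and eq: "emeasure lborel X = ennreal (pi * \<rho>\<^sup>2)"
    and ab: "0 \<le> a" "a < b" "b \<le> \<rho>"
  obtains t where "a < t" "t < b" "len X (x0 - t) + len X (x0 + t) = 4 * sqrt (\<rho>\<^sup>2 - t\<^sup>2)"
proof -
  let ?f = "\<lambda>t. indicator {0<..<\<rho>} t * ennreal (len X (x0 - t) + len X (x0 + t))"
  let ?g = "\<lambda>t. indicator {0<..<\<rho>} t * ennreal (4 * sqrt (\<rho>\<^sup>2 - t\<^sup>2))"
  have [measurable]: "len X \<in> borel_measurable borel" by measurable
  have "emeasure lborel X \<le> (\<integral>\<^sup>+t. ?f t \<partial>lborel)"
    by (rule folded_slices_le[OF X bd w]) simp_all
  then have ge: "(\<integral>\<^sup>+t. ?g t \<partial>lborel) \<le> (\<integral>\<^sup>+t. ?f t \<partial>lborel)"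
    unfolding eq half_chord_integral[OF \<open>0 \<le> \<rho>\<close>] .
  have fg: "AE t in lborel. ?f t \<le> ?g t"
    using le by eventually_elim (auto simp: indicator_def simp del: ennreal_plus intro!: ennreal_leI)
  have fin: "(\<integral>\<^sup>+t. ?f t \<partial>lborel) \<noteq> \<infinity>"
  proof -
    have "(\<integral>\<^sup>+t. ?f t \<partial>lborel) \<le> (\<integral>\<^sup>+t. ?g t \<partial>lborel)" by (rule nn_integral_mono_AE[OF fg])
    then show ?thesis unfolding half_chord_integral[OF \<open>0 \<le> \<rho>\<close>] by (auto simp: top_unique)
  qed
  have "AE t in lborel. ?g t \<le> ?f t"
  proof (rule ccontr)
    assume "\<not> ?thesis"
    then have "(\<integral>\<^sup>+t. ?f t \<partial>lborel) < (\<integral>\<^sup>+t. ?g t \<partial>lborel)"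
      by (intro nn_integral_less fin fg) auto
    then show False using ge by simp
  qed
  then have ae: "AE t in lborel. 0 < t \<longrightarrow> t < \<rho> \<longrightarrow> len X (x0 - t) + len X (x0 + t) = 4 * sqrt (\<rho>\<^sup>2 - t\<^sup>2)"
    using le
  proof eventually_elim
    case (elim t)
    show ?case
    proof (intro impI)
      assume t: "0 < t" "t < \<rho>"
      then have "ennreal (4 * sqrt (\<rho>\<^sup>2 - t\<^sup>2)) \<le> ennreal (len X (x0 - t) + len X (x0 + t))"
        using elim(1) by (simp del: ennreal_plus)
      then have "4 * sqrt (\<rho>\<^sup>2 - t\<^sup>2) \<le> len X (x0 - t) + len X (x0 + t)"
        by (simp add: ennreal_le_iff del: ennreal_plus)
      then show "len X (x0 - t) + len X (x0 + t) = 4 * sqrt (\<rho>\<^sup>2 - t\<^sup>2)" using elim(2) t by simp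
    qed
  qed
  have "\<exists>t. a < t \<and> t < b \<and> len X (x0 - t) + len X (x0 + t) = 4 * sqrt (\<rho>\<^sup>2 - t\<^sup>2)"
  proof (rule ccontr)
    assume no: "\<not> ?thesis"
    have "AE t in lborel. t \<notin> {a<..<b}"
      using ae by eventually_elim (use no ab in auto)
    then have "{a<..<b} \<in> null_sets lborel"
      by (subst AE_iff_null_sets) auto
    then have "emeasure lborel {a<..<b} = 0" by auto
    then show False using ab by simp
  qed
  then show ?thesis using that by blast
qed

section \<open>Lengths of slices\<close>

lemma measure_real_le_range:
  fixes S :: "real set"
  assumes "\<And>y y'. y \<in> S \<Longrightarrow> y' \<in> S \<Longrightarrow> y' - y \<le> \<delta>" "0 \<le> \<delta>" "S \<in> sets borel"
  shows "measure lborel S \<le> \<delta>"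
proof (cases "S = {}")
  case False
  then obtain y0 where y0: "y0 \<in> S" by auto
  have bb: "bdd_below S" by (rule bdd_belowI[of _ "y0 - \<delta>"]) (use assms(1)[OF _ y0] in force)
  have "S \<subseteq> {Inf S .. Inf S + \<delta>}"
  proof
    fix y assume y: "y \<in> S"
    have "y - \<delta> \<le> Inf S" by (rule cInf_greatest[OF False]) (use assms(1)[OF _ y] in force)
    then show "y \<in> {Inf S .. Inf S + \<delta>}" using cInf_lower[OF y bb] by auto
  qed
  then have "measure lborel S \<le> measure lborel {Inf S .. Inf S + \<delta>}"
    by (intro measure_mono_fmeasurable) (use assms in \<open>auto simp: fmeasurable_def\<close>)
  then show ?thesis using assms(2) by simp
qed (use assms in simp)

text \<open>
  Each of the two sets lies in an interval from its infimum to its supremum, and the supremum of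
  one exceeds the infimum of the other by at most \<open>\<tau>\<close>; add up the two lengths.
  Neither set may be empty: the other one would then be unconstrained, and this is the source of
  the case distinctions on empty slices later on.
\<close>
lemma measure_real_pair_le:
  fixes S T :: "real set"
  assumes ne: "S \<noteq> {}" "T \<noteq> {}"
    and d: "\<And>y y'. y \<in> S \<Longrightarrow> y' \<in> T \<Longrightarrow> \<bar>y - y'\<bar> \<le> \<tau>"
    and m: "S \<in> sets borel" "T \<in> sets borel"
  shows "measure lborel S + measure lborel T \<le> 2 * \<tau>"
proof -
  have range: "measure lborel A \<le> Sup A - Inf A"
    if "A \<noteq> {}" "bdd_below A" "bdd_above A" "A \<in> sets borel" for A :: "real set"
  proof (rule measure_real_le_range[OF _ _ that(4)])
    show "y' - y \<le> Sup A - Inf A" if "y \<in> A" "y' \<in> A" for y y'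
      using cSup_upper[OF that(2) \<open>bdd_above A\<close>] cInf_lower[OF that(1) \<open>bdd_below A\<close>] by linarith
    show "0 \<le> Sup A - Inf A"
      using cInf_le_cSup[OF that(1,3,2)] by linarith
  qed
  have bd: "bdd_below A \<and> bdd_above A \<and> Sup A \<le> Inf B + \<tau>"
    if "A \<noteq> {}" "B \<noteq> {}" and dd: "\<And>y y'. y \<in> A \<Longrightarrow> y' \<in> B \<Longrightarrow> \<bar>y - y'\<bar> \<le> \<tau>" for A B :: "real set"
  proof -
    obtain b where b: "b \<in> B" using \<open>B \<noteq> {}\<close> by blast
    have 1: "b - \<tau> \<le> y \<and> y \<le> b + \<tau>" if "y \<in> A" for y
      using dd[OF that b] by linarith
    have "y \<le> Inf B + \<tau>" if y: "y \<in> A" for y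
    proof -
      have "y - \<tau> \<le> Inf B"
      proof (rule cInf_greatest[OF \<open>B \<noteq> {}\<close>])
        show "y - \<tau> \<le> y'" if "y' \<in> B" for y' using dd[OF y that] by linarith
      qed
      then show ?thesis by linarith
    qed
    then have "Sup A \<le> Inf B + \<tau>" using cSup_least[OF \<open>A \<noteq> {}\<close>] by blast
    moreover have "bdd_below A" "bdd_above A" unfolding bdd_below_def bdd_above_def using 1 by blast+
    ultimately show ?thesis by blast
  qed
  have d': "\<bar>y' - y\<bar> \<le> \<tau>" if "y' \<in> T" "y \<in> S" for y y'
    using d[OF that(2,1)] by linarith
  have S: "bdd_below S \<and> bdd_above S \<and> Sup S \<le> Inf T + \<tau>"
    by (rule bd[OF ne]) (rule d)
  have T: "bdd_below T \<and> bdd_above T \<and> Sup T \<le> Inf S + \<tau>"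
    by (rule bd[OF ne(2,1)]) (rule d')
  show ?thesis
proof -
    have "measure lborel S \<le> Sup S - Inf S" using range[OF ne(1) _ _ m(1)] S by simp
    moreover have "measure lborel T \<le> Sup T - Inf T" using range[OF ne(2) _ _ m(2)] T by simp
    ultimately show ?thesis using S T by linarith
  qed
qed

lemma sqrt_diff_scale: "2 * sqrt ((2 * \<rho>)\<^sup>2 - (2 * t)\<^sup>2) = 4 * sqrt (\<rho>\<^sup>2 - t\<^sup>2)" for \<rho> t :: real
proof -
  have "(2 * \<rho>)\<^sup>2 - (2 * t)\<^sup>2 = 4 * (\<rho>\<^sup>2 - t\<^sup>2)" by (simp add: power_mult_distrib)
  then show ?thesis by (simp add: real_sqrt_mult del: right_diff_distrib_numeral)
qed

text \<open>
  Pythagoras: points of distance at most \<open>r\<close> on two vertical lines differ in height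
  by at most \<open>sqrt (r\<^sup>2 - (x - x')\<^sup>2)\<close>.
\<close>
lemma len_pair_le:
  assumes X: "X \<in> sets borel" and ne: "slice X x \<noteq> {}" "slice X x' \<noteq> {}" and r: "0 \<le> r"
    and d: "\<And>y y'. (x, y) \<in> X \<Longrightarrow> (x', y') \<in> X \<Longrightarrow> dist (x, y) (x', y') \<le> r"
  shows "len X x + len X x' \<le> 2 * sqrt (r\<^sup>2 - (x - x')\<^sup>2)"
  unfolding len_def
proof (rule measure_real_pair_le[OF ne])
  fix y y' assume "y \<in> slice X x" "y' \<in> slice X x'"
  then have "dist (x, y) (x', y') \<le> r" using d by (simp add: slice_def)
  then have "(y - y')\<^sup>2 \<le> r\<^sup>2 - (x - x')\<^sup>2" using dist_plane_le_iff[OF r] by simp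
  then show "\<bar>y - y'\<bar> \<le> sqrt (r\<^sup>2 - (x - x')\<^sup>2)" using real_le_rsqrt[of "\<bar>y - y'\<bar>"] by simp
qed (use X in auto)

lemma len_le_chord:
  assumes X: "X \<in> sets borel" and r: "0 \<le> r" and x: "(x - a)\<^sup>2 \<le> r\<^sup>2"
    and d: "\<And>y. (x, y) \<in> X \<Longrightarrow> dist (a, b) (x, y) \<le> r"
  shows "len X x \<le> 2 * sqrt (r\<^sup>2 - (x - a)\<^sup>2)"
  unfolding len_def
proof (rule measure_real_le_range)
  have "\<bar>y - b\<bar> \<le> sqrt (r\<^sup>2 - (x - a)\<^sup>2)" if "y \<in> slice X x" for y
  proof -
    have "dist (x, y) (a, b) \<le> r" using d that by (simp add: slice_def dist_commute)
    then have "(y - b)\<^sup>2 \<le> r\<^sup>2 - (x - a)\<^sup>2" using dist_plane_le_iff[OF r] by simp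
    then show ?thesis using real_le_rsqrt[of "\<bar>y - b\<bar>"] by simp
  qed
  then show "y' - y \<le> 2 * sqrt (r\<^sup>2 - (x - a)\<^sup>2)" if "y \<in> slice X x" "y' \<in> slice X x" for y y'
    using that by (smt (verit))
qed (use X x in auto)

text \<open>
  The hypotheses say that \<open>(0, 0)\<close> and \<open>(d, 0)\<close> may be added to
  \<open>X\<close> without creating distances above \<open>d\<close>. The two points take care of
  a pair of slices one of which is empty: the other one is then a subset of a chord of the disc of
  radius \<open>d\<close> around the farther of the two points.
\<close>
lemma folded_len_le_diametral:
  fixes X :: "(real \<times> real) set"
  assumes X: "X \<in> sets borel" and t: "0 < t" "t < d / 2"
    and B: "X \<subseteq> cball (0, 0) d" "X \<subseteq> cball (d, 0) d"
    and d: "\<And>z z'. z \<in> X \<Longrightarrow> z' \<in> X \<Longrightarrow> dist z z' \<le> d"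
  shows "len X (d / 2 - t) + len X (d / 2 + t) \<le> 4 * sqrt ((d / 2)\<^sup>2 - t\<^sup>2)"
proof -
  have d0: "0 \<le> d" using t by simp
  have tt: "(2 * t)\<^sup>2 \<le> (d / 2 + t)\<^sup>2" using t by (intro power_mono) auto
  have dd: "(d / 2 + t)\<^sup>2 \<le> d\<^sup>2" using t by (intro power_mono) auto
  have le: "2 * sqrt (d\<^sup>2 - (d / 2 + t)\<^sup>2) \<le> 2 * sqrt ((2 * (d / 2))\<^sup>2 - (2 * t)\<^sup>2)"
    using tt by simp
  have e: "4 * sqrt ((d / 2)\<^sup>2 - t\<^sup>2) = 2 * sqrt ((2 * (d / 2))\<^sup>2 - (2 * t)\<^sup>2)"
    by (rule sqrt_diff_scale[symmetric])
  consider "slice X (d / 2 - t) = {}" | "slice X (d / 2 + t) = {}"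
    | "slice X (d / 2 - t) \<noteq> {}" "slice X (d / 2 + t) \<noteq> {}" by blast
  then show ?thesis
  proof cases
    case 1
    have "len X (d / 2 + t) \<le> 2 * sqrt (d\<^sup>2 - (d / 2 + t)\<^sup>2)"
    proof -
      have "dist (0, 0) (d / 2 + t, y) \<le> d" if "(d / 2 + t, y) \<in> X" for y
        using B(1) that by (meson mem_cball subsetD)
      then show ?thesis using len_le_chord[OF X d0, of "d / 2 + t" 0 0] dd by simp
    qed
    then show ?thesis unfolding e using le len_empty[OF 1] by linarith
  next
    case 2
    have "len X (d / 2 - t) \<le> 2 * sqrt (d\<^sup>2 - (d / 2 - t - d)\<^sup>2)"
      by (rule len_le_chord[OF X d0, of _ _ 0]) (use B dd in \<open>auto simp: power2_eq_square algebra_simps\<close>)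
    moreover have "(d / 2 - t - d)\<^sup>2 = (d / 2 + t)\<^sup>2" by (simp add: power2_eq_square algebra_simps)
    ultimately have "len X (d / 2 - t) \<le> 2 * sqrt (d\<^sup>2 - (d / 2 + t)\<^sup>2)" by (simp only:)
    then show ?thesis unfolding e using le len_empty[OF 2] by linarith
  next
    case 3
    have "len X (d / 2 - t) + len X (d / 2 + t) \<le> 2 * sqrt (d\<^sup>2 - ((d / 2 - t) - (d / 2 + t))\<^sup>2)"
      by (rule len_pair_le[OF X 3 d0]) (rule d)
    moreover have "((d / 2 - t) - (d / 2 + t))\<^sup>2 = (2 * t)\<^sup>2" by (simp add: power2_eq_square)
    ultimately show ?thesis unfolding e by simp
  qed
qed

lemma diametral_strip:
  fixes X :: "(real \<times> real) set"
  assumes "X \<subseteq> cball (0, 0) d" "X \<subseteq> cball (d, 0) d" "z \<in> X"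
  shows "\<bar>fst z - d / 2\<bar> \<le> d / 2"
proof -
  have "dist (0,0) z \<le> d" "dist (d,0) z \<le> d" using assms by auto
  moreover have "dist (fst (0::real,0::real)) (fst z) \<le> dist (0,0) z" "dist (fst (d,0::real)) (fst z) \<le> dist (d,0) z"
    by (rule dist_fst_le)+
  ultimately have "\<bar>fst z\<bar> \<le> d" "\<bar>fst z - d\<bar> \<le> d"
    by (simp_all add: dist_real_def abs_minus_commute)
  then show ?thesis by linarith
qed

lemma isodiametric_diametral:
  fixes X :: "(real \<times> real) set"
  assumes X: "X \<in> sets borel" and d0: "0 \<le> d"
    and B: "X \<subseteq> cball (0, 0) d" "X \<subseteq> cball (d, 0) d"
    and d: "\<And>z z'. z \<in> X \<Longrightarrow> z' \<in> X \<Longrightarrow> dist z z' \<le> d"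
  shows "emeasure lborel X \<le> ennreal (pi * (d / 2)\<^sup>2)"
proof (rule strip_area_le[OF X])
  show "bounded X" using B(1) bounded_cball bounded_subset by blast
  show "\<bar>fst z - d / 2\<bar> \<le> d / 2" if "z \<in> X" for z
    by (rule diametral_strip[OF B that])
  show "AE t in lborel. 0 < t \<longrightarrow> t < d / 2 \<longrightarrow>
      len X (d / 2 - t) + len X (d / 2 + t) \<le> 4 * sqrt ((d / 2)\<^sup>2 - t\<^sup>2)"
    using folded_len_le_diametral[OF X _ _ B d] by simp
qed (use d0 in auto)

section \<open>Triangle-free sets of moderate diameter\<close>

definition triangle_free :: "'a::metric_space set \<Rightarrow> bool" where
  "triangle_free K \<longleftrightarrow> (\<forall>p\<in>K. \<forall>q\<in>K. \<forall>r\<in>K. dist p q \<le> 2 \<or> dist p r \<le> 2 \<or> dist q r \<le> 2)"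

lemma triangle_freeD:
  "triangle_free K \<Longrightarrow> p \<in> K \<Longrightarrow> q \<in> K \<Longrightarrow> r \<in> K \<Longrightarrow> 2 < dist p q \<Longrightarrow> 2 < dist p r \<Longrightarrow> dist q r \<le> 2"
  unfolding triangle_free_def by (meson not_le)

lemma has_integral_sqrt:
  assumes "0 \<le> b"
  shows "(sqrt has_integral (2 / 3) * b * sqrt b) {0..b}"
proof -
  have "((\<lambda>x. sqrt x) has_integral (\<lambda>x. (2 / 3) * x * sqrt x) b - (\<lambda>x. (2 / 3) * x * sqrt x) 0) {0..b}"
  proof (rule fundamental_theorem_of_calculus_interior[OF assms])
    show "continuous_on {0..b} (\<lambda>x. 2 / 3 * x * sqrt x)" by (intro continuous_intros)
    show "((\<lambda>x. 2 / 3 * x * sqrt x) has_vector_derivative sqrt x) (at x)" if "x \<in> {0<..<b}" for x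
    proof -
      have "((\<lambda>x. 2 / 3 * x * sqrt x) has_real_derivative (2 / 3) * sqrt x + (2 / 3) * x * (inverse (sqrt x) / 2)) (at x)"
        using that by (auto intro!: derivative_eq_intros)
      moreover have "(2 / 3) * sqrt x + (2 / 3) * x * (inverse (sqrt x) / 2) = sqrt x"
        using that by (simp add: field_simps real_div_sqrt) 
      ultimately show ?thesis by (simp add: has_real_derivative_iff_has_vector_derivative)
    qed
  qed
  then show ?thesis by simp
qed

lemma nn_integral_sqrt:
  assumes "0 < d" "0 \<le> b"
  shows "(\<integral>\<^sup>+x. indicator {0..b} x * ennreal (4 * sqrt (d * x)) \<partial>lborel) = ennreal (8 / 3 * b * sqrt (d * b))"
proof -
  have "((\<lambda>x. (4 * sqrt d) * sqrt x) has_integral (4 * sqrt d) * ((2 / 3) * b * sqrt b)) {0..b}"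
    by (rule has_integral_mult_right[OF has_integral_sqrt[OF assms(2)]])
  then have "((\<lambda>x. 4 * sqrt (d * x)) has_integral (8 / 3 * b * sqrt (d * b))) {0..b}"
    by (simp add: real_sqrt_mult mult_ac)
  then have "integral\<^sup>N lborel (\<lambda>x. ennreal (indicator {0..b} x * (4 * sqrt (d * x)))) = ennreal (8 / 3 * b * sqrt (d * b))"
    using assms by (intro nn_integral_has_integral_lebesgue) auto
  then show ?thesis
    by (simp add: ennreal_mult' ennreal_indicator)
qed


text \<open>
  The set \<open>S\<close> is a vertical slice of a set covered by two discs of radius 2, whose
  centres, on a horizontal line, are at squared horizontal distances
  \<open>\<alpha> \<le> \<beta>\<close> from the slice. It lies in the chord of half-length
  \<open>sqrt (4 - \<alpha>)\<close>, and its points outside the smaller chord, of half-length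
  \<open>sqrt (4 - \<beta>)\<close>, are pairwise close. So either it sticks out of the smaller
  chord at one end only, and its length is at most the sum of the two half-lengths, or it sticks
  out at both ends and its whole range is at most 2.
\<close>
lemma measure_slice_middle_le:
  fixes S :: "real set"
  assumes S: "S \<in> sets borel" and ab: "\<alpha> \<le> \<beta>" "\<beta> \<le> 4"
    and cover: "\<And>y. y \<in> S \<Longrightarrow> \<alpha> + y\<^sup>2 \<le> 4 \<or> \<beta> + y\<^sup>2 \<le> 4"
    and far: "\<And>y y'. y \<in> S \<Longrightarrow> y' \<in> S \<Longrightarrow> 4 < \<beta> + y\<^sup>2 \<Longrightarrow> 4 < \<beta> + y'\<^sup>2 \<Longrightarrow> \<bar>y - y'\<bar> \<le> 2"
    and c: "2 \<le> c" "2 * (8 - \<alpha> - \<beta>) \<le> c\<^sup>2"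
  shows "measure lborel S \<le> c"
proof (rule measure_real_le_range[OF _ _ S])
  define H where "H = sqrt (4 - \<alpha>)"
  define h where "h = sqrt (4 - \<beta>)"
  have h0: "0 \<le> h" using ab by (simp add: h_def)
  have H: "- H \<le> y" "y \<le> H" if "y \<in> S" for y
  proof -
    have "y\<^sup>2 \<le> 4 - \<alpha>" using cover[OF that] ab by linarith
    then show "- H \<le> y" "y \<le> H" using square_le_iff_sqrt[of "4 - \<alpha>" y] ab by (auto simp: H_def)
  qed
  have h: "4 < \<beta> + y\<^sup>2 \<longleftrightarrow> y < - h \<or> h < y" for y
    using square_le_iff_sqrt[of "4 - \<beta>" y] ab by (auto simp: h_def)
  have hH: "h + H \<le> c"
  proof (rule power2_le_imp_le)
    have "(h + H)\<^sup>2 \<le> 2 * (h\<^sup>2 + H\<^sup>2)" using sum_squares_bound[of h H] by (simp add: power2_sum)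
    also have "h\<^sup>2 + H\<^sup>2 = 8 - \<alpha> - \<beta>" using ab by (simp add: h_def H_def)
    finally show "(h + H)\<^sup>2 \<le> c\<^sup>2" using c by linarith
  qed (use c in simp)
  fix y y' assume y: "y \<in> S" "y' \<in> S"
  show "y' - y \<le> c"
  proof (cases "(\<exists>y1\<in>S. h < y1) \<and> (\<exists>y2\<in>S. y2 < - h)")
    case True
    then obtain y1 y2 where y12: "y1 \<in> S" "h < y1" "y2 \<in> S" "y2 < - h" by auto
    \<comment> \<open>Enlarging the pair makes both points lie outside the smaller chord.\<close>
    have "max y' y1 \<in> S" "min y y2 \<in> S" using y y12 by (auto simp: max_def min_def)
    moreover have "h < max y' y1" "min y y2 < - h" using y12 by auto
    ultimately have "\<bar>max y' y1 - min y y2\<bar> \<le> 2" using far h by blast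
    then show ?thesis using c by linarith
  next
    case False
    then have "y' \<le> h \<or> - h \<le> y" using y by force
    then show ?thesis using H[OF y(1)] H[OF y(2)] hH by linarith
  qed
qed (use c in simp)

text \<open>
  The left-hand side increases on the interval considered and stays below \<open>2 * pi\<close> at
  \<open>d = 157 / 50\<close> by less than \<open>0.02\<close>. The threshold
  \<open>157 / 50\<close> is a compromise: this bound fails soon beyond it, and the treatment of
  larger diameters needs \<open>d\<close> to exceed 3 by a margin.
\<close>
lemma moderate_diameter_numeric_bound:
  fixes d :: real
  assumes "8 \<le> d\<^sup>2" "0 \<le> d" "d \<le> 157 / 50"
  shows "(4 - d) * sqrt (16 - d\<^sup>2) + 4 * (d - 1 / d - 2) + 8 / 3 * (1 / d) < 2 * pi"
proof -
  have d: "282 / 100 \<le> d"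
  proof (rule power2_le_imp_le)
    show "(282 / 100)\<^sup>2 \<le> d\<^sup>2" using assms by (simp add: power2_eq_square)
  qed (use assms in simp)
  \<comment> \<open>The square root is about \<open>5 / 2\<close> at the critical end of the interval, where this bound is nearly sharp.\<close>
  have "sqrt (16 - d\<^sup>2) \<le> (16 - d\<^sup>2 + (5/2)\<^sup>2) / 5"
  proof -
    have "2 * sqrt (16 - d\<^sup>2) * (5/2) \<le> (sqrt (16 - d\<^sup>2))\<^sup>2 + (5/2)\<^sup>2"
      by (rule sum_squares_bound)
    moreover have "d\<^sup>2 \<le> 4\<^sup>2" using assms by (intro power_mono) auto
    ultimately show ?thesis by simp
  qed
  then have "(4 - d) * sqrt (16 - d\<^sup>2) \<le> (4 - d) * ((16 - d\<^sup>2 + (5/2)\<^sup>2) / 5)"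
    using assms by (intro mult_left_mono) auto
  moreover have "4 * (d - 1 / d - 2) + 8 / 3 * (1 / d) = 4 * d - 8 - 4 / 3 * (1 / d)"
    by (simp add: field_simps)
  moreover have "50 / 157 \<le> 1 / d" using assms d by (simp add: field_simps)
  \<comment> \<open>Up to a constant and a tiny linear term, this product is the cubic polynomial in \<open>d\<close> that remains.\<close>
  moreover have "(d - 157 / 50) * (d * (d - 43 / 50) - 495 / 100) \<le> 0"
  proof (rule mult_nonpos_nonneg)
    have "(282 / 100) * (282 / 100 - 43 / 50) \<le> d * (d - 43 / 50)"
      using d by (intro mult_mono) auto
    then show "0 \<le> d * (d - 43 / 50) - 495 / 100" by simp
  qed (use assms in simp)
  moreover have "(4 - d) * ((16 - d\<^sup>2 + (5/2)\<^sup>2) / 5) + 4 * d - 8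
      = ((d - 157 / 50) * (d * (d - 43 / 50) - 495 / 100) + 33457 / 1000 - d / 2500) / 5"
    by (simp add: power2_eq_square field_simps)
  moreover have "31415 / 10000 \<le> pi" using pi_approx by simp
  moreover have "a + c1 + c2 < 2 * p"
    if "a \<le> b" "c1 + c2 = 4 * d - 8 - 4 / 3 * e" "50 / 157 \<le> e" "P \<le> 0"
      "b + 4 * d - 8 = (P + 33457 / 1000 - d / 2500) / 5" "31415 / 10000 \<le> p" for a b c1 c2 e P p :: real
    using that d by argo
  ultimately show ?thesis by blast
qed


text \<open>
  Three bounds on the slices, folded about the line \<open>x = d / 2\<close>, suffice for these
  diameters. A slice that misses the lens of the discs of radius 2 around the two diametral points
  contains only points far from one of them, hence has length at most 2. A slice through the lens
  has length at most \<open>sqrt (16 - d\<^sup>2)\<close>. Close to the two ends the isodiametric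
  bound is better; it is weakened to \<open>4 * sqrt (d * x)\<close> at distance \<open>x\<close>
  from the end, which drops below \<open>4\<close> for \<open>x < 1 / d\<close>.
\<close>
lemma moderate_diameter_area_less:
  fixes K :: "(real \<times> real) set"
  assumes K: "K \<in> sets borel" and pq: "(0, 0) \<in> K" "(d, 0) \<in> K"
    and tf: "triangle_free K"
    and diam: "\<And>z z'. z \<in> K \<Longrightarrow> z' \<in> K \<Longrightarrow> dist z z' \<le> d"
    and d8: "8 \<le> d\<^sup>2" and d3: "d \<le> 157 / 50"
  shows "emeasure lborel K < ennreal (2 * pi)"
proof -
  have d0: "0 \<le> d" using diam[OF pq] by (meson dual_order.trans zero_le_dist)
  have d28: "28 / 10 \<le> d"
  proof (rule power2_le_imp_le)
    show "(28 / 10)\<^sup>2 \<le> d\<^sup>2" using d8 by (simp add: power2_eq_square)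
  qed (use d0 in simp)
  have pq2: "2 < dist (0::real, 0::real) (d, 0)" using d28 by (simp add: dist_Pair_Pair)
  have B: "K \<subseteq> cball (0, 0) d" "K \<subseteq> cball (d, 0) d" using diam pq by auto
  have bd: "bounded K" using B(1) bounded_cball bounded_subset by blast
  have cover: "x\<^sup>2 + y\<^sup>2 \<le> 4 \<or> (d - x)\<^sup>2 + y\<^sup>2 \<le> 4" if "(x, y) \<in> K" for x y
  proof -
    have "dist (0, 0) (x, y) \<le> 2 \<or> dist (d, 0) (x, y) \<le> 2"
      using triangle_freeD[OF tf pq that pq2] by linarith
    then show ?thesis by (simp add: dist_plane_le_iff power2_commute)
  qed
  have far: "dist z z' \<le> 2" if "z \<in> K" "z' \<in> K" "r \<in> K" "2 < dist r z" "2 < dist r z'" for z z' r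
    using triangle_freeD[OF tf that(3,1,2,4,5)] .
  define c where "c = sqrt (16 - d\<^sup>2)"
  have d16: "d\<^sup>2 \<le> 10"
  proof -
    have "d\<^sup>2 \<le> (157 / 50)\<^sup>2" using d0 d3 by (intro power_mono) auto
    then show ?thesis by (simp add: power2_eq_square)
  qed
  have c2: "c\<^sup>2 = 16 - d\<^sup>2" using d16 by (simp add: c_def)
  have c_ge: "2 \<le> c" unfolding c_def using d16 by (intro real_le_rsqrt) simp
  have far0: "\<bar>y - y'\<bar> \<le> 2"
    if "(x, y) \<in> K" "(x, y') \<in> K" "4 < x\<^sup>2 + y\<^sup>2" "4 < x\<^sup>2 + y'\<^sup>2" for x y y'
  proof -
    have "2 < dist (0, 0) (x, y)" "2 < dist (0, 0) (x, y')"
      using that by (simp_all add: not_le[symmetric] dist_plane_le_iff)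
    from far[OF that(1,2) pq(1) this] show ?thesis by (simp add: dist_Pair_Pair dist_real_def)
  qed
  have fard: "\<bar>y - y'\<bar> \<le> 2"
    if "(x, y) \<in> K" "(x, y') \<in> K" "4 < (d - x)\<^sup>2 + y\<^sup>2" "4 < (d - x)\<^sup>2 + y'\<^sup>2" for x y y'
  proof -
    have "2 < dist (d, 0) (x, y)" "2 < dist (d, 0) (x, y')"
      using that by (simp_all add: not_le[symmetric] dist_plane_le_iff)
    from far[OF that(1,2) pq(2) this] show ?thesis by (simp add: dist_Pair_Pair dist_real_def)
  qed
  have outer: "len K (d / 2 - t) \<le> 2 \<and> len K (d / 2 + t) \<le> 2" if "2 - d / 2 < t" "0 < t" for t
  proof
    have "2\<^sup>2 < (d / 2 + t)\<^sup>2" using that by (intro power_strict_mono) auto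
    then have q: "4 < (d / 2 + t)\<^sup>2 + y\<^sup>2" for y :: real
      using zero_le_power2[of y] unfolding power2_eq_square by linarith
    have e: "d - (d / 2 - t) = d / 2 + t" by simp
    show "len K (d / 2 - t) \<le> 2" unfolding len_def
    proof (rule measure_real_le_range)
      fix y y' assume "y \<in> slice K (d / 2 - t)" "y' \<in> slice K (d / 2 - t)"
      then have "\<bar>y - y'\<bar> \<le> 2" using fard[of "d / 2 - t" y y'] q unfolding slice_def e by blast
      then show "y' - y \<le> 2" by simp
    qed (use K in auto)
    show "len K (d / 2 + t) \<le> 2" unfolding len_def
    proof (rule measure_real_le_range)
      fix y y' assume "y \<in> slice K (d / 2 + t)" "y' \<in> slice K (d / 2 + t)"
      then have "\<bar>y - y'\<bar> \<le> 2" using far0[of "d / 2 + t" y y'] q unfolding slice_def by blast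
      then show "y' - y \<le> 2" by simp
    qed (use K in auto)
  qed
  have middle: "len K (d / 2 - t) \<le> c \<and> len K (d / 2 + t) \<le> c" if "0 < t" "t \<le> 2 - d / 2" for t
  proof -
    define \<alpha> where "\<alpha> = (d / 2 - t)\<^sup>2"
    define \<beta> where "\<beta> = (d / 2 + t)\<^sup>2"
    have "\<bar>d / 2 - t\<bar> \<le> \<bar>d / 2 + t\<bar>" using that d0 by linarith
    then have ab: "\<alpha> \<le> \<beta>" unfolding \<alpha>_def \<beta>_def abs_le_square_iff .
    have "(d / 2 + t)\<^sup>2 \<le> 2\<^sup>2" using that d0 by (intro power_mono) auto
    then have b4: "\<beta> \<le> 4" by (simp add: \<beta>_def)
    have "\<alpha> + \<beta> = d\<^sup>2 / 2 + 2 * t\<^sup>2" by (simp add: \<alpha>_def \<beta>_def power2_eq_square field_simps)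
    then have cc: "2 * (8 - \<alpha> - \<beta>) \<le> c\<^sup>2" unfolding c2 using zero_le_power2[of t] by argo
    have e: "d - (d / 2 - t) = d / 2 + t" "d - (d / 2 + t) = d / 2 - t" by simp_all
    show ?thesis unfolding len_def
    proof
      show "measure lborel (slice K (d / 2 - t)) \<le> c"
      proof (rule measure_slice_middle_le[OF _ ab b4 _ _ c_ge cc])
        show "\<alpha> + y\<^sup>2 \<le> 4 \<or> \<beta> + y\<^sup>2 \<le> 4" if "y \<in> slice K (d / 2 - t)" for y
          using cover[of "d / 2 - t" y] that unfolding slice_def \<alpha>_def \<beta>_def e by blast
        show "\<bar>y - y'\<bar> \<le> 2" if "y \<in> slice K (d / 2 - t)" "y' \<in> slice K (d / 2 - t)"
          "4 < \<beta> + y\<^sup>2" "4 < \<beta> + y'\<^sup>2" for y y'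
          using fard[of "d / 2 - t" y y'] that unfolding slice_def \<beta>_def e by blast
      qed (use K in auto)
      show "measure lborel (slice K (d / 2 + t)) \<le> c"
      proof (rule measure_slice_middle_le[OF _ ab b4 _ _ c_ge cc])
        show "\<alpha> + y\<^sup>2 \<le> 4 \<or> \<beta> + y\<^sup>2 \<le> 4" if "y \<in> slice K (d / 2 + t)" for y
          using cover[of "d / 2 + t" y] that unfolding slice_def \<alpha>_def \<beta>_def e by blast
        show "\<bar>y - y'\<bar> \<le> 2" if "y \<in> slice K (d / 2 + t)" "y' \<in> slice K (d / 2 + t)"
          "4 < \<beta> + y\<^sup>2" "4 < \<beta> + y'\<^sup>2" for y y'
          using far0[of "d / 2 + t" y y'] that unfolding slice_def \<beta>_def by blast
      qed (use K in auto)
    qed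
  qed
  have tail: "len K (d / 2 - t) + len K (d / 2 + t) \<le> 4 * sqrt (d * (d / 2 - t))" if "0 < t" "t < d / 2" for t
  proof -
    have "len K (d / 2 - t) + len K (d / 2 + t) \<le> 4 * sqrt ((d / 2)\<^sup>2 - t\<^sup>2)"
      by (rule folded_len_le_diametral[OF K that B diam])
    also have "(d / 2)\<^sup>2 - t\<^sup>2 = (d / 2 + t) * (d / 2 - t)" by (simp add: power2_eq_square algebra_simps)
    also have "4 * sqrt ((d / 2 + t) * (d / 2 - t)) \<le> 4 * sqrt (d * (d / 2 - t))"
      using that by (intro mult_left_mono real_sqrt_le_mono mult_right_mono) auto
    finally show ?thesis .
  qed
  \<comment> \<open>The folded slice meets the lens for \<open>t \<le> ?m\<close>; the isodiametric bound takes over for \<open>t > ?u\<close>.\<close>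
  let ?m = "2 - d / 2" and ?u = "d / 2 - 1 / d"
  have u: "0 \<le> ?m" "?m \<le> ?u" "?u \<le> d / 2"
  proof -
    have "1 / d \<le> 1 / (28 / 10)" using d28 by (intro divide_left_mono) auto
    then show "?m \<le> ?u" using d28 by simp
  qed (use d28 d3 in auto)
  let ?g = "\<lambda>t. if t \<le> ?m then 2 * c else if t \<le> ?u then 4 else 4 * sqrt (d * (d / 2 - t))"
  let ?A = "\<lambda>t. indicator {0..?m} t * ennreal (2 * c)"
  let ?B = "\<lambda>t. indicator {?m..?u} t * ennreal 4"
  let ?C = "\<lambda>t. indicator {?u..d / 2} t * ennreal (4 * sqrt (d * (d / 2 - t)))"
  have "emeasure lborel K \<le> (\<integral>\<^sup>+t. indicator {0<..<d / 2} t * ennreal (?g t) \<partial>lborel)"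
  proof (rule folded_slices_le[OF K bd diametral_strip[OF B]])
    have "len K (d / 2 - t) + len K (d / 2 + t) \<le> ?g t" if "0 < t" "t < d / 2" for t
      using middle[of t] outer[of t] tail[of t] that by auto
    then show "AE t in lborel. 0 < t \<longrightarrow> t < d / 2 \<longrightarrow> len K (d / 2 - t) + len K (d / 2 + t) \<le> ?g t"
      by simp
  qed
  also have "\<dots> \<le> (\<integral>\<^sup>+t. ?A t + ?B t + ?C t \<partial>lborel)"
  proof (intro nn_integral_mono)
    fix t :: real
    consider "t \<notin> {0<..<d / 2}" | "0 < t" "t \<le> ?m" | "?m < t" "t \<le> ?u" | "?u < t" "t < d / 2" by force
    then show "indicator {0<..<d / 2} t * ennreal (?g t) \<le> ?A t + ?B t + ?C t"
      by cases (use u in \<open>auto simp: indicator_def\<close>)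
  qed
  also have "\<dots> = (\<integral>\<^sup>+t. ?A t \<partial>lborel) + (\<integral>\<^sup>+t. ?B t \<partial>lborel) + (\<integral>\<^sup>+t. ?C t \<partial>lborel)"
    by (subst nn_integral_add; (subst nn_integral_add)?) auto
  also have "(\<integral>\<^sup>+t. ?A t \<partial>lborel) = ennreal (?m * (2 * c))"
    using u c_ge by (subst nn_integral_multc) (auto simp: ennreal_mult)
  also have "(\<integral>\<^sup>+t. ?B t \<partial>lborel) = ennreal ((?u - ?m) * 4)"
  proof -
    have "(\<integral>\<^sup>+t. ?B t \<partial>lborel) = ennreal (?u - ?m) * ennreal 4"
      using u by (subst nn_integral_multc) auto
    also have "\<dots> = ennreal ((?u - ?m) * 4)"
      using u by (intro ennreal_mult[symmetric]) auto
    finally show ?thesis .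
  qed
  also have "(\<integral>\<^sup>+t. ?C t \<partial>lborel) = (\<integral>\<^sup>+x. indicator {0..1 / d} x * ennreal (4 * sqrt (d * x)) \<partial>lborel)"
    by (subst nn_integral_real_affine[where c="-1" and t="d / 2"])
       (auto intro!: nn_integral_cong simp: indicator_def)
  also have "\<dots> = ennreal (8 / 3 * (1 / d))"
    using nn_integral_sqrt[of d "1 / d"] d28 by simp
  also have "ennreal (?m * (2 * c)) + ennreal ((?u - ?m) * 4) + ennreal (8 / 3 * (1 / d))
      = ennreal (?m * (2 * c) + (?u - ?m) * 4 + 8 / 3 * (1 / d))"
    using u c_ge d28 by (simp add: ennreal_plus[symmetric] del: ennreal_plus)
  also have "?m * (2 * c) + (?u - ?m) * 4 + 8 / 3 * (1 / d)
      = (4 - d) * c + 4 * (d - 1 / d - 2) + 8 / 3 * (1 / d)"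
    by (simp add: algebra_simps)
  also have "ennreal \<dots> < ennreal (2 * pi)"
    using moderate_diameter_numeric_bound[OF d8 d0 d3] by (intro ennreal_lessI) (auto simp: c_def)
  finally show ?thesis .
qed

section \<open>A one-sided isodiametric inequality\<close>

text \<open>
  The points of \<open>X\<close> need only be close to each other when they are jointly far to the
  left. That is enough for the slices at \<open>x\<close> and \<open>s - x\<close>, where
  \<open>s\<close> is the right end of \<open>X\<close>.

  The delicate case is that the right slice is empty and the left one, at \<open>x\<close>, is too
  long. Its length is at most 2, so \<open>x\<close> is small; this is where
  \<open>\<sigma>\<close> has to exceed 2 by \<open>7 / 50\<close>. A point of \<open>X\<close> to
  the right of \<open>s - x\<close> would be within distance 2 of two points of the left slice
  that are more than \<open>4 * sqrt (1 - t\<^sup>2)\<close> apart, which is impossible as it is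
  horizontally even farther away than a point of the right slice. Hence \<open>X\<close> ends at
  or before \<open>s - x\<close>, contrary to the choice of \<open>s\<close>.
\<close>
lemma left_near_pair_len_le:
  fixes X :: "(real \<times> real) set"
  assumes X: "X \<in> sets borel" and ne: "X \<noteq> {}"
    and B: "\<And>z. z \<in> X \<Longrightarrow> dist (0, 0) z \<le> 2"
    and near: "\<And>z z'. z \<in> X \<Longrightarrow> z' \<in> X \<Longrightarrow> fst z + fst z' < \<sigma> \<Longrightarrow> dist z z' \<le> 2"
    and \<sigma>: "107 / 50 \<le> \<sigma>"
    and up: "\<And>z. z \<in> X \<Longrightarrow> fst z \<le> s"
    and least: "\<And>u. (\<And>z. z \<in> X \<Longrightarrow> fst z \<le> u) \<Longrightarrow> s \<le> u"
    and s2: "s \<le> 2" and t: "0 < t" "t < s / 2"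
  shows "len X (s / 2 - t) + len X (s / 2 + t) \<le> 4 * sqrt (1 - t\<^sup>2)"
proof -
  let ?x = "s / 2 - t" and ?x' = "s / 2 + t"
  have e: "2 * sqrt (2\<^sup>2 - (2 * t)\<^sup>2) = 4 * sqrt (1 - t\<^sup>2)"
    using sqrt_diff_scale[of 1 t] by simp
  have t1: "t\<^sup>2 < 1" using t s2 by (simp add: abs_square_less_1)
  consider "slice X ?x = {}" | "slice X ?x' = {}" | "slice X ?x \<noteq> {}" "slice X ?x' \<noteq> {}" by blast
  then show ?thesis
  proof cases
    case 1
    have xx: "(2 * t)\<^sup>2 \<le> ?x'\<^sup>2" "?x'\<^sup>2 \<le> 2\<^sup>2" using t s2 by (intro power_mono; simp)+
    have "len X ?x' \<le> 2 * sqrt (2\<^sup>2 - (?x' - 0)\<^sup>2)"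
      by (rule len_le_chord[OF X, where b=0]) (use xx B in auto)
    also have "\<dots> \<le> 2 * sqrt (2\<^sup>2 - (2 * t)\<^sup>2)" using xx by simp
    finally show ?thesis unfolding e using len_empty[OF 1] by simp
  next
    case 3
    have "len X ?x + len X ?x' \<le> 2 * sqrt (2\<^sup>2 - (?x - ?x')\<^sup>2)"
      by (rule len_pair_le[OF X 3]) (use near s2 \<sigma> in auto)
    moreover have "(?x - ?x')\<^sup>2 = (2 * t)\<^sup>2" by (simp add: power2_eq_square)
    ultimately show ?thesis unfolding e[symmetric] by (simp only:)
  next
    case 2
    have l2: "len X ?x \<le> 2" unfolding len_def
    proof (rule measure_real_le_range)
      fix y y' assume "y \<in> slice X ?x" "y' \<in> slice X ?x"
      then have "dist (?x, y) (?x, y') \<le> 2" using near[of "(?x, y)" "(?x, y')"] t s2 \<sigma> by (simp add: slice_def)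
      then show "y' - y \<le> 2" by (simp add: dist_Pair_Pair dist_real_def)
    qed (use X in auto)
    have "len X ?x \<le> 4 * sqrt (1 - t\<^sup>2)"
    proof (rule ccontr)
      assume big: "\<not> ?thesis"
      then obtain y1 y2 where y: "(?x, y1) \<in> X" "(?x, y2) \<in> X" "4 * sqrt (1 - t\<^sup>2) < y2 - y1"
        using measure_real_le_range[of "slice X ?x" "4 * sqrt (1 - t\<^sup>2)"] X t1
        unfolding len_def slice_def by (force simp: not_le)
      have "sqrt (1 - t\<^sup>2) < 1 / 2" using big l2 by linarith
      then have "1 - t\<^sup>2 < (1 / 2)\<^sup>2" using real_less_rsqrt[of "1 / 2" "1 - t\<^sup>2"] by (meson not_less real_le_rsqrt)
      then have "(86 / 100)\<^sup>2 < t\<^sup>2" by (simp add: power2_eq_square)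
      then have t86: "86 / 100 < t" using t by (meson less_imp_le power_less_imp_less_base)
      have "fst z \<le> ?x'" if z: "z \<in> X" for z
      proof (rule ccontr)
        assume "\<not> fst z \<le> ?x'"
        then have far: "2 * t \<le> fst z - ?x" by simp
        have "fst z + ?x < \<sigma>" using up[OF z] s2 t86 \<sigma> by simp
        then have d: "dist z (?x, y1) \<le> 2" "dist z (?x, y2) \<le> 2" using near[OF z y(1)] near[OF z y(2)] by auto
        have "(2 * t)\<^sup>2 \<le> (fst z - ?x)\<^sup>2" using far t by (intro power_mono) auto
        then have "(snd z - y1)\<^sup>2 \<le> 2\<^sup>2 - (2 * t)\<^sup>2" "(snd z - y2)\<^sup>2 \<le> 2\<^sup>2 - (2 * t)\<^sup>2"
          using d by (simp_all add: dist_plane_le_iff)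
        then have "\<bar>snd z - y1\<bar> \<le> sqrt (2\<^sup>2 - (2 * t)\<^sup>2)" "\<bar>snd z - y2\<bar> \<le> sqrt (2\<^sup>2 - (2 * t)\<^sup>2)"
          using real_le_rsqrt[of "\<bar>snd z - y1\<bar>"] real_le_rsqrt[of "\<bar>snd z - y2\<bar>"] by simp_all
        then show False using y(3) e by linarith
      qed
      then have "s \<le> ?x'" by (rule least)
      then show False using t by simp
    qed
    then show ?thesis using len_empty[OF 2] by simp
  qed
qed

text \<open>
  If the right end \<open>s\<close> of \<open>X\<close> is less than 2, there are no slices at
  distance more than \<open>s / 2\<close> from the axis of reflection, and the comparison with the
  unit disc is strict. So area \<open>pi\<close> forces \<open>s = 2\<close>, which is the second
  claim, and the axis is then the line at abscissa 1.
\<close>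
lemma left_near_area:
  fixes X :: "(real \<times> real) set"
  assumes X: "X \<in> sets borel"
    and B: "\<And>z. z \<in> X \<Longrightarrow> dist (0, 0) z \<le> 2"
    and pos: "\<And>z. z \<in> X \<Longrightarrow> 0 \<le> fst z"
    and near: "\<And>z z'. z \<in> X \<Longrightarrow> z' \<in> X \<Longrightarrow> fst z + fst z' < \<sigma> \<Longrightarrow> dist z z' \<le> 2"
    and \<sigma>: "107 / 50 \<le> \<sigma>"
  shows left_near_area_le: "emeasure lborel X \<le> ennreal pi"
    and left_near_area_eq_tip: "emeasure lborel X = ennreal pi \<Longrightarrow> 0 < \<epsilon> \<Longrightarrow> \<exists>z\<in>X. 2 - \<epsilon> < fst z"
    and left_near_area_eq_middle: "emeasure lborel X = ennreal pi \<Longrightarrow> 0 < \<epsilon> \<Longrightarrow>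
      \<exists>t. 0 < t \<and> t < \<epsilon> \<and> len X (1 - t) + len X (1 + t) = 4 * sqrt (1 - t\<^sup>2)"
proof -
  have all: "emeasure lborel X \<le> ennreal pi \<and> (emeasure lborel X = ennreal pi \<longrightarrow> 0 < \<epsilon> \<longrightarrow>
      (\<exists>z\<in>X. 2 - \<epsilon> < fst z) \<and>
      (\<exists>t. 0 < t \<and> t < \<epsilon> \<and> len X (1 - t) + len X (1 + t) = 4 * sqrt (1 - t\<^sup>2)))" for \<epsilon>
  proof (cases "X = {}")
    case False
    define s where "s = Sup (fst ` X)"
    have fst2: "fst z \<le> 2" if "z \<in> X" for z
    proof -
      have "dist (fst (0::real,0::real)) (fst z) \<le> dist (0, 0) z" by (rule dist_fst_le)
      then show ?thesis using B[OF that] by (simp add: dist_real_def)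
    qed
    have bdd: "bdd_above (fst ` X)" unfolding bdd_above_def using fst2 by blast
    have up: "fst z \<le> s" if "z \<in> X" for z unfolding s_def by (rule cSup_upper[OF _ bdd]) (use that in auto)
    have least: "s \<le> u" if "\<And>z. z \<in> X \<Longrightarrow> fst z \<le> u" for u
      unfolding s_def by (rule cSup_least) (use False that in auto)
    have s2: "s \<le> 2" by (rule least) (rule fst2)
    have bd: "bounded X"
      by (rule bounded_subset[OF bounded_cball[of "(0,0)" 2]]) (use B in auto)
    have w: "\<bar>fst z - s / 2\<bar> \<le> s / 2" if "z \<in> X" for z using up[OF that] pos[OF that] by linarith
    then have w1: "\<bar>fst z - s / 2\<bar> \<le> 1" if "z \<in> X" for z using w[OF that] s2 by linarith
    have zero: "len X (s / 2 - t) + len X (s / 2 + t) = 0" if "s / 2 < t" for t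
    proof -
      have "0 \<le> s" using False up pos by (meson all_not_in_conv order_trans)
      then have "slice X (s / 2 - t) = {}" "slice X (s / 2 + t) = {}"
        using w[of "(s / 2 - t, _)"] w[of "(s / 2 + t, _)"] that by (auto simp: slice_def)
      then show ?thesis by (simp add: len_empty)
    qed
    have le: "AE t in lborel. 0 < t \<longrightarrow> t < 1 \<longrightarrow>
        len X (s / 2 - t) + len X (s / 2 + t) \<le> 4 * sqrt (1\<^sup>2 - t\<^sup>2)"
      using AE_lborel_singleton[of "s / 2"]
    proof eventually_elim
      case (elim t)
      show ?case
      proof (intro impI)
        assume t: "0 < t" "t < 1"
        show "len X (s / 2 - t) + len X (s / 2 + t) \<le> 4 * sqrt (1\<^sup>2 - t\<^sup>2)"
        proof (cases "t < s / 2")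
          case True
          then show ?thesis using left_near_pair_len_le[OF X False B near \<sigma> up least s2 t(1)] by simp
        next
          case False
          then have "len X (s / 2 - t) + len X (s / 2 + t) = 0" using elim zero by simp
          moreover have "t\<^sup>2 \<le> 1" using t by (simp add: power_le_one)
          ultimately show ?thesis by simp
        qed
      qed
    qed
    have "emeasure lborel X \<le> ennreal (pi * 1\<^sup>2)"
      by (rule strip_area_le[OF X bd _ w1 le]) auto
    moreover have "(\<exists>z\<in>X. 2 - \<epsilon> < fst z) \<and>
      (\<exists>t. 0 < t \<and> t < \<epsilon> \<and> len X (1 - t) + len X (1 + t) = 4 * sqrt (1 - t\<^sup>2))"
      if eq: "emeasure lborel X = ennreal pi" and \<epsilon>: "0 < \<epsilon>"
    proof -
      have eq': "emeasure lborel X = ennreal (pi * 1\<^sup>2)" using eq by simp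
      have s: "s = 2"
      proof (rule ccontr)
        assume "s \<noteq> 2"
        then have "max 0 (s / 2) < 1" using s2 by auto
        then obtain t where t: "max 0 (s / 2) < t" "t < 1"
            "len X (s / 2 - t) + len X (s / 2 + t) = 4 * sqrt (1\<^sup>2 - t\<^sup>2)"
          using strip_area_eq[OF X bd _ w1 le eq', of "max 0 (s / 2)" 1] by auto
        then have "4 * sqrt (1\<^sup>2 - t\<^sup>2) = 0" using zero[of t] by simp
        moreover have "t\<^sup>2 < 1" using t by (simp add: abs_square_less_1)
        ultimately show False by simp
      qed
      have "\<exists>z\<in>X. 2 - \<epsilon> < fst z"
        using least[of "2 - \<epsilon>"] s \<epsilon> by force
      moreover obtain t where "0 < t" "t < min 1 \<epsilon>"
            "len X (s / 2 - t) + len X (s / 2 + t) = 4 * sqrt (1\<^sup>2 - t\<^sup>2)"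
        using strip_area_eq[OF X bd _ w1 le eq', of 0 "min 1 \<epsilon>"] \<epsilon> by auto
      ultimately show ?thesis using s by auto
    qed
    ultimately show ?thesis by simp
  qed (use pi_gt_zero in \<open>simp add: not_le\<close>)
  show "emeasure lborel X \<le> ennreal pi" using all[of 1] by blast
  show "emeasure lborel X = ennreal pi \<Longrightarrow> 0 < \<epsilon> \<Longrightarrow> \<exists>z\<in>X. 2 - \<epsilon> < fst z" using all[of \<epsilon>] by blast
  show "emeasure lborel X = ennreal pi \<Longrightarrow> 0 < \<epsilon> \<Longrightarrow>
      \<exists>t. 0 < t \<and> t < \<epsilon> \<and> len X (1 - t) + len X (1 + t) = 4 * sqrt (1 - t\<^sup>2)" using all[of \<epsilon>] by blast
qed

lemma add_pi_bounds_tight: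
  assumes "a \<le> ennreal pi" "b \<le> ennreal pi" "ennreal (2 * pi) \<le> a + b"
  shows "a = ennreal pi \<and> b = ennreal pi"
proof -
  obtain x y where "a = ennreal x" "b = ennreal y" "0 \<le> x" "0 \<le> y"
    using assms(1,2) by (metis ennreal_cases ennreal_less_top leD)
  then show ?thesis using assms by (auto simp: ennreal_plus[symmetric] simp del: ennreal_plus)
qed

section \<open>Triangle-free sets of larger diameter\<close>

definition mirror :: "real \<Rightarrow> real \<times> real \<Rightarrow> real \<times> real" where
  "mirror d z = (d - fst z, snd z)"

lemma mirror_mirror [simp]: "mirror d (mirror d z) = z"
  by (simp add: mirror_def)

lemma fst_mirror [simp]: "fst (mirror d z) = d - fst z"
  by (simp add: mirror_def)

lemma dist_mirror [simp]: "dist (mirror d z) (mirror d z') = dist z z'"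
  by (simp add: mirror_def dist_prod_def dist_real_def abs_minus_commute)

lemma dist_mirror_left: "dist (mirror d z) z' = dist z (mirror d z')"
  using dist_mirror[of d "z" "mirror d z'"] by simp

lemma vimage_mirror_eq_image: "mirror d -` X = mirror d ` X"
proof
  show "mirror d -` X \<subseteq> mirror d ` X"
    using mirror_mirror by (metis image_eqI subsetI vimageD)
qed auto

lemma continuous_mirror: "continuous_on S (mirror d)"
  unfolding mirror_def[abs_def] by (intro continuous_intros)

lemma mirror_borel: "X \<in> sets borel \<Longrightarrow> mirror d -` X \<in> sets borel"
  using measurable_sets[of "mirror d" borel borel X]
    borel_measurable_continuous_onI[OF continuous_mirror] by simp

lemma emeasure_mirror:
  assumes X: "X \<in> sets borel" and bd: "bounded X"
  shows "emeasure lborel (mirror d -` X) = emeasure lborel X"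
proof -
  have "bounded (mirror d -` X)" unfolding vimage_mirror_eq_image
    by (rule bounded_subset[OF compact_imp_bounded[OF compact_continuous_image[OF continuous_mirror compact_closure[THEN iffD2, OF bd]]]])
       (use closure_subset in blast)
  then have "emeasure lborel (mirror d -` X) = (\<integral>\<^sup>+x. ennreal (len (mirror d -` X) x) \<partial>lborel)"
    by (rule emeasure_eq_slices[OF mirror_borel[OF X]])
  also have "\<dots> = (\<integral>\<^sup>+x. ennreal (len X (d - x)) \<partial>lborel)"
    by (simp add: len_def slice_def mirror_def)
  also have "\<dots> = (\<integral>\<^sup>+x. ennreal (len X x) \<partial>lborel)"
    using X by (subst nn_integral_real_affine[where c="-1" and t=d and f="\<lambda>x. ennreal (len X x)"]) auto
  also have "\<dots> = emeasure lborel X" by (rule emeasure_eq_slices[OF X bd, symmetric])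
  finally show ?thesis .
qed


lemma dist_fst_ge: "\<bar>fst z - fst z'\<bar> \<le> dist z z'" for z z' :: "real \<times> real"
  using dist_fst_le[of z z'] by (simp add: dist_real_def)

text \<open>
  A triangle-free set in coordinates that put a diametral pair at \<open>(0, 0)\<close> and
  \<open>(d, 0)\<close>, with \<open>d\<close> in the range in which the discs of radius 2 around
  these points overlap in a narrow lens. Of the diametral property only the inclusion in a
  vertical strip is recorded.
\<close>
definition wide :: "(real \<times> real) set \<Rightarrow> real \<Rightarrow> bool" where
  "wide K d \<longleftrightarrow> compact K \<and> triangle_free K \<and> (0, 0) \<in> K \<and> (d, 0) \<in> K \<and>
     (\<forall>z\<in>K. 0 \<le> fst z \<and> fst z \<le> d) \<and> 157 / 50 \<le> d \<and> d < 4"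

lemma wide_mirror:
  assumes "wide K d" shows "wide (mirror d -` K) d"
proof -
  have "compact (mirror d -` K)"
    unfolding vimage_mirror_eq_image
    using assms by (intro compact_continuous_image continuous_mirror) (simp add: wide_def)
  moreover have "triangle_free (mirror d -` K)"
    using assms unfolding wide_def triangle_free_def by (metis dist_mirror vimageD)
  ultimately show ?thesis
    using assms by (auto simp: wide_def) (auto simp: mirror_def)
qed

text \<open>
  The set is to be split into two sets of area at most \<open>pi\<close>. Points far from
  \<open>(d, 0)\<close> go to the left, points far from \<open>(0, 0)\<close> go to the right. A
  point of the lens goes to the left unless it is far from some point with which it forms a pair
  that is jointly far to the left. As the inequalities in this condition are strict, the set of
  lens points sent to the right is relatively open, which makes both parts measurable.
\<close>
definition left_part :: "(real \<times> real) set \<Rightarrow> real \<Rightarrow> (real \<times> real) set" where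
  "left_part K d = {z \<in> K. dist (0, 0) z \<le> 2 \<and>
     (2 < dist (d, 0) z \<or> (\<forall>a\<in>K. fst a + fst z < d - 1 \<longrightarrow> dist a z \<le> 2))}"

lemma left_part_borel:
  assumes "compact K" shows "left_part K d \<in> sets borel"
proof -
  let ?U = "\<Union>a\<in>K. {z. fst z < d - 1 - fst a} \<inter> {z. 2 < dist a z}"
  have "open {z :: real \<times> real. fst z < d - 1 - fst a}" for a :: "real \<times> real"
    by (intro open_Collect_less continuous_intros)
  moreover have "open {z. 2 < dist a z}" for a :: "real \<times> real"
    by (intro open_Collect_less continuous_intros)
  ultimately have U: "open ?U" by blast
  have "left_part K d = K \<inter> cball (0, 0) 2 - (cball (d, 0) 2 \<inter> ?U)"
    unfolding left_part_def by (auto simp: not_le algebra_simps)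
  then show ?thesis
    using U compact_imp_closed[OF assms] by auto
qed

context
  fixes K :: "(real \<times> real) set" and d :: real
  assumes wide: "wide K d"
begin

lemma wide_facts:
  "compact K" "triangle_free K" "(0, 0) \<in> K" "(d, 0) \<in> K" "157 / 50 \<le> d" "d < 4"
  "z \<in> K \<Longrightarrow> 0 \<le> fst z" "z \<in> K \<Longrightarrow> fst z \<le> d"
  using wide by (auto simp: wide_def)

lemma wide_cover: "z \<in> K \<Longrightarrow> dist (0, 0) z \<le> 2 \<or> dist (d, 0) z \<le> 2"
  using triangle_freeD[OF wide_facts(2,3,4), of z] wide_facts(5) by (force simp: dist_Pair_Pair not_le)

lemma wide_near_left:
  "z \<in> K \<Longrightarrow> z' \<in> K \<Longrightarrow> 2 < dist (d, 0) z \<Longrightarrow> 2 < dist (d, 0) z' \<Longrightarrow> dist z z' \<le> 2"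
  by (rule triangle_freeD[OF wide_facts(2,4)])

lemma wide_near_right:
  "z \<in> K \<Longrightarrow> z' \<in> K \<Longrightarrow> 2 < dist (0, 0) z \<Longrightarrow> 2 < dist (0, 0) z' \<Longrightarrow> dist z z' \<le> 2"
  by (rule triangle_freeD[OF wide_facts(2,3)])

lemma left_part_near:
  assumes "z \<in> left_part K d" "z' \<in> left_part K d" "fst z + fst z' < d - 1"
  shows "dist z z' \<le> 2"
proof -
  have K: "z \<in> K" "z' \<in> K" using assms by (auto simp: left_part_def)
  consider "2 < dist (d, 0) z" "2 < dist (d, 0) z'"
    | "\<forall>a\<in>K. fst a + fst z < d - 1 \<longrightarrow> dist a z \<le> 2"
    | "\<forall>a\<in>K. fst a + fst z' < d - 1 \<longrightarrow> dist a z' \<le> 2"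
    using assms(1,2) by (auto simp: left_part_def)
  then show ?thesis
  proof cases
    case 1 then show ?thesis by (rule wide_near_left[OF K])
  next
    case 2 then show ?thesis using K assms(3) by (auto simp: dist_commute add.commute)
  next
    case 3 then show ?thesis using K assms(3) by auto
  qed
qed

lemma right_part_cases:
  assumes "z \<in> K - left_part K d"
  shows "dist (d, 0) z \<le> 2"
    "2 < dist (0, 0) z \<or> (\<exists>a\<in>K. fst a + fst z < d - 1 \<and> 2 < dist a z)"
  using assms wide_cover[of z] by (auto simp: left_part_def not_le)

text \<open>
  The bounds \<open>d - 1\<close> and \<open>d + 1\<close> are chosen for this argument. If a lens
  point \<open>b\<close> was sent to the right because of a far point \<open>a\<close> on the
  left, and if \<open>c\<close> is a point jointly far to the right with \<open>b\<close>, then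
  \<open>c\<close> is more than 2 to the right of \<open>a\<close>. Were \<open>b\<close> far from
  \<open>c\<close>, then \<open>a\<close>, \<open>b\<close>, \<open>c\<close> would form a
  triangle.
\<close>
lemma right_part_near:
  assumes "z \<in> K - left_part K d" "z' \<in> K - left_part K d" "d + 1 < fst z + fst z'"
  shows "dist z z' \<le> 2"
proof -
  have K: "z \<in> K" "z' \<in> K" using assms by auto
  have *: "dist c b \<le> 2" if "a \<in> K" "b \<in> K" "c \<in> K" "fst a + fst b < d - 1" "2 < dist a b"
    "d + 1 < fst c + fst b" for a b c
  proof -
    have "2 < \<bar>fst a - fst c\<bar>" using that by linarith
    then have "2 < dist a c" using dist_fst_ge[of a c] by linarith
    from triangle_freeD[OF wide_facts(2) that(1,3,2) this that(5)] show ?thesis .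
  qed
  from right_part_cases(2)[OF assms(1)] right_part_cases(2)[OF assms(2)]
  consider "2 < dist (0, 0) z" "2 < dist (0, 0) z'"
    | a where "a \<in> K" "fst a + fst z < d - 1" "2 < dist a z"
    | a where "a \<in> K" "fst a + fst z' < d - 1" "2 < dist a z'" by blast
  then show ?thesis
  proof cases
    case 1 then show ?thesis by (rule wide_near_right[OF K])
  next
    case 2 then show ?thesis using *[of a z z'] K assms(3) by (simp add: dist_commute add.commute)
  next
    case 3 then show ?thesis using *[of a z' z] K assms(3) by simp
  qed
qed

lemma wide_parts_borel: "K \<in> sets borel" "left_part K d \<in> sets borel" "bounded K"
  using wide_facts(1) left_part_borel by (auto intro: borel_compact compact_imp_bounded)

lemma left_part_bounds:
  "z \<in> left_part K d \<Longrightarrow> dist (0, 0) z \<le> 2" "z \<in> left_part K d \<Longrightarrow> 0 \<le> fst z" "107 / 50 \<le> d - 1"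
  using wide_facts(5) wide_facts(7)[of z] by (auto simp: left_part_def)

lemma right_part_bounds:
  assumes "z \<in> mirror d -` (K - left_part K d)"
  shows "dist (0, 0) z \<le> 2" "0 \<le> fst z"
proof -
  have "mirror d z \<in> K - left_part K d" using assms by blast
  moreover from right_part_cases(1)[OF this] have "dist (mirror d (d, 0)) z \<le> 2"
    by (simp only: dist_mirror_left)
  ultimately show "dist (0, 0) z \<le> 2" "0 \<le> fst z"
    using wide_facts(8)[of "mirror d z"] by (auto simp: mirror_def)
qed

lemma right_part_mirror_near:
  assumes "z \<in> mirror d -` (K - left_part K d)" "z' \<in> mirror d -` (K - left_part K d)" "fst z + fst z' < d - 1"
  shows "dist z z' \<le> 2"
  using right_part_near[of "mirror d z" "mirror d z'"] assms by simp

lemma wide_area_split: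
  shows "emeasure lborel (left_part K d) \<le> ennreal pi"
    and "emeasure lborel (mirror d -` (K - left_part K d)) \<le> ennreal pi"
    and "emeasure lborel K = emeasure lborel (left_part K d) + emeasure lborel (mirror d -` (K - left_part K d))"
proof -
  let ?Y = "K - left_part K d"
  have Y: "?Y \<in> sets borel" using wide_parts_borel by auto
  show "emeasure lborel (left_part K d) \<le> ennreal pi"
    by (rule left_near_area_le[OF wide_parts_borel(2) left_part_bounds(1,2) left_part_near left_part_bounds(3)])
  show "emeasure lborel (mirror d -` ?Y) \<le> ennreal pi"
    by (rule left_near_area_le[OF mirror_borel[OF Y] right_part_bounds right_part_mirror_near left_part_bounds(3)])
  have "left_part K d \<subseteq> K" by (auto simp: left_part_def)
  then have "emeasure lborel (left_part K d) + emeasure lborel ?Y = emeasure lborel K"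
    using wide_parts_borel by (subst plus_emeasure) (auto simp: Un_absorb1)
  moreover have "emeasure lborel (mirror d -` ?Y) = emeasure lborel ?Y"
    by (rule emeasure_mirror[OF Y]) (use wide_parts_borel(3) bounded_subset in blast)
  ultimately show "emeasure lborel K = emeasure lborel (left_part K d) + emeasure lborel (mirror d -` ?Y)"
    by simp
qed

lemma wide_area_le: "emeasure lborel K \<le> ennreal (2 * pi)"
proof -
  have "emeasure lborel K \<le> ennreal pi + ennreal pi"
    unfolding wide_area_split(3) by (rule add_mono[OF wide_area_split(1,2)])
  then show ?thesis by (simp flip: ennreal_plus)
qed

lemma wide_area_eq_parts:
  assumes "emeasure lborel K = ennreal (2 * pi)"
  shows "emeasure lborel (left_part K d) = ennreal pi"
    and "emeasure lborel (mirror d -` (K - left_part K d)) = ennreal pi"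
proof -
  show "emeasure lborel (left_part K d) = ennreal pi"
    "emeasure lborel (mirror d -` (K - left_part K d)) = ennreal pi"
    using add_pi_bounds_tight[OF wide_area_split(1,2)] wide_area_split(3) assms by simp_all
qed

end

text \<open>
  If both parts have area \<open>pi\<close>, the right part reaches its extreme abscissa
  \<open>d - 2\<close>, so it has points \<open>b n\<close> converging to the left tip
  \<open>(d - 2, 0)\<close> of the lens. They belong to the right part only because of far points
  \<open>a n\<close>, and \<open>a\<close> is a limit point of these. The last property says that
  the tip inherits the role of a neighbour of \<open>a\<close>, up to non-strict inequalities.
\<close>
lemma wide_tip:
  assumes wide: "wide K d" and area: "emeasure lborel K = ennreal (2 * pi)"
  obtains a where "a \<in> K" "fst a \<le> 1" "2 \<le> dist a (d - 2, 0)"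
    "\<And>z. z \<in> K \<Longrightarrow> 2 < dist z a \<Longrightarrow> dist z (d - 2, 0) \<le> 2"
proof -
  note wf = wide_facts[OF wide]
  let ?Y = "K - left_part K d"
  have Y: "?Y \<in> sets borel" using wide_parts_borel[OF wide] by auto
  have tip: "\<exists>z\<in>mirror d -` ?Y. 2 - \<epsilon> < fst z" if "0 < \<epsilon>" for \<epsilon>
    by (rule left_near_area_eq_tip[OF mirror_borel[OF Y] right_part_bounds[OF wide] right_part_mirror_near[OF wide]
          left_part_bounds(3)[OF wide] wide_area_eq_parts(2)[OF wide area] that])
  have "\<exists>b. b \<in> ?Y \<and> fst b < d - 2 + inverse (real (Suc n))" for n
  proof -
    have "0 < inverse (real (Suc n))" by simp
    from tip[OF this] obtain z where "z \<in> mirror d -` ?Y" "2 - inverse (real (Suc n)) < fst z" by blast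
    then show ?thesis by (intro exI[of _ "mirror d z"]) auto
  qed
  then obtain b where b: "\<And>n. b n \<in> ?Y" "\<And>n. fst (b n) < d - 2 + inverse (real (Suc n))" by metis
  have bK: "b n \<in> K" for n using b(1) by blast
  have bd: "(d - fst (b n))\<^sup>2 + (snd (b n))\<^sup>2 \<le> 4" for n
    using right_part_cases(1)[OF wide b(1)] by (simp add: dist_plane_le_iff)
  have b_ge: "d - 2 \<le> fst (b n)" for n
  proof -
    have "(d - fst (b n))\<^sup>2 \<le> 4" using bd[of n] zero_le_power2[of "snd (b n)"] by linarith
    then have "(d - fst (b n))\<^sup>2 \<le> 2\<^sup>2" by simp
    then have "d - fst (b n) \<le> 2" by (rule power2_le_imp_le) simp
    then show ?thesis by simp
  qed
  have fst_lim: "(\<lambda>n. fst (b n)) \<longlonglongrightarrow> d - 2"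
  proof (rule tendsto_sandwich[of "\<lambda>_. d - 2" _ _ "\<lambda>n. d - 2 + inverse (real (Suc n))"])
    show "(\<lambda>n. d - 2 + inverse (real (Suc n))) \<longlonglongrightarrow> d - 2"
      using tendsto_add[OF tendsto_const LIMSEQ_inverse_real_of_nat] by force
    show "\<forall>\<^sub>F n in sequentially. fst (b n) \<le> d - 2 + inverse (real (Suc n))"
      using b(2) by (intro always_eventually) (auto intro: less_imp_le)
  qed (use b_ge in auto)
  have "(\<lambda>n. (snd (b n))\<^sup>2) \<longlonglongrightarrow> 0"
  proof (rule tendsto_sandwich[of "\<lambda>_. 0" _ _ "\<lambda>n. 4 - (d - fst (b n))\<^sup>2"])
    have "(\<lambda>n. 4 - (d - fst (b n))\<^sup>2) \<longlonglongrightarrow> 4 - (d - (d - 2))\<^sup>2"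
      by (intro tendsto_intros fst_lim)
    then show "(\<lambda>n. 4 - (d - fst (b n))\<^sup>2) \<longlonglongrightarrow> 0" by simp
    show "\<forall>\<^sub>F n in sequentially. (snd (b n))\<^sup>2 \<le> 4 - (d - fst (b n))\<^sup>2"
      using bd by (intro always_eventually) (auto simp: algebra_simps)
  qed auto
  then have "(\<lambda>n. sqrt ((snd (b n))\<^sup>2)) \<longlonglongrightarrow> sqrt 0" by (rule tendsto_real_sqrt)
  then have snd_lim: "(\<lambda>n. snd (b n)) \<longlonglongrightarrow> 0" by (simp add: tendsto_rabs_zero_iff)
  have b_lim: "b \<longlonglongrightarrow> (d - 2, 0)"
    using tendsto_Pair[OF fst_lim snd_lim] by simp
  have "(\<lambda>n. dist (0, 0) (b n)) \<longlonglongrightarrow> dist (0, 0) (d - 2, 0::real)"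
    by (intro tendsto_intros b_lim)
  moreover have "dist (0, 0) (d - 2, 0::real) < 2" using wf(5,6) by (simp add: dist_Pair_Pair)
  ultimately have "\<forall>\<^sub>F n in sequentially. dist (0, 0) (b n) < 2" by (rule order_tendstoD(2))
  then have "\<forall>\<^sub>F n in sequentially. \<exists>a. a \<in> K \<and> fst a + fst (b n) < d - 1 \<and> 2 < dist a (b n)"
    by (rule eventually_mono) (use right_part_cases(2)[OF wide b(1)] in \<open>force simp: not_less\<close>)
  then obtain N where N: "\<And>n. N \<le> n \<Longrightarrow> \<exists>a. a \<in> K \<and> fst a + fst (b n) < d - 1 \<and> 2 < dist a (b n)"
    unfolding eventually_sequentially by blast
  define b' where "b' n = b (n + N)" for n
  have b'_lim: "b' \<longlonglongrightarrow> (d - 2, 0)" unfolding b'_def using b_lim by (rule LIMSEQ_ignore_initial_segment)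
  have "\<exists>a. a \<in> K \<and> fst a + fst (b' n) < d - 1 \<and> 2 < dist a (b' n)" for n
    unfolding b'_def by (rule N) simp
  then obtain a where a: "\<And>n. a n \<in> K" "\<And>n. fst (a n) + fst (b' n) < d - 1" "\<And>n. 2 < dist (a n) (b' n)"
    by metis
  obtain l r where l: "l \<in> K" "strict_mono r" "(a \<circ> r) \<longlonglongrightarrow> l"
    using wf(1) a(1) unfolding compact_def by metis
  have br: "(b' \<circ> r) \<longlonglongrightarrow> (d - 2, 0)" by (rule LIMSEQ_subseq_LIMSEQ[OF b'_lim l(2)])
  show ?thesis
  proof
    show "l \<in> K" by fact
    have "(\<lambda>n. fst ((a \<circ> r) n) + fst ((b' \<circ> r) n)) \<longlonglongrightarrow> fst l + fst (d - 2, 0::real)"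
      by (intro tendsto_intros l(3) br)
    then have "fst l + fst (d - 2, 0::real) \<le> d - 1"
      by (rule LIMSEQ_le_const2) (use a(2) in \<open>auto intro: less_imp_le\<close>)
    then show "fst l \<le> 1" by simp
    have "(\<lambda>n. dist ((a \<circ> r) n) ((b' \<circ> r) n)) \<longlonglongrightarrow> dist l (d - 2, 0)"
      by (intro tendsto_intros l(3) br)
    then show "2 \<le> dist l (d - 2, 0)"
      by (rule LIMSEQ_le_const) (use a(3) in \<open>auto intro: less_imp_le\<close>)
    show "dist z (d - 2, 0) \<le> 2" if z: "z \<in> K" "2 < dist z l" for z
    proof (rule tendsto_upperbound)
      show "(\<lambda>n. dist z ((b' \<circ> r) n)) \<longlonglongrightarrow> dist z (d - 2, 0)"
        by (intro tendsto_intros br)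
      have "(\<lambda>n. dist z ((a \<circ> r) n)) \<longlonglongrightarrow> dist z l" by (intro tendsto_intros l(3))
      then have "\<forall>\<^sub>F n in sequentially. 2 < dist z ((a \<circ> r) n)" using z(2) by (rule order_tendstoD(1))
      then show "\<forall>\<^sub>F n in sequentially. dist z ((b' \<circ> r) n) \<le> 2"
      proof (rule eventually_mono)
        fix n assume "2 < dist z ((a \<circ> r) n)"
        then have "2 < dist (a (r n)) z" by (simp add: dist_commute)
        moreover have "b' (r n) \<in> K" unfolding b'_def by (rule bK)
        ultimately show "dist z ((b' \<circ> r) n) \<le> 2"
          using triangle_freeD[OF wf(2) a(1) z(1) _ _ a(3)] by simp
      qed
    qed simp
  qed
qed

text \<open>
  Suppose that the area is \<open>2 * pi\<close>, and take the points \<open>a\<close> and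
  \<open>c\<close> that the previous lemma provides for the left and for the right tip of the
  lens. Being within 2 of \<open>(0, 0)\<close> and at least 2 from the left tip, \<open>a\<close>
  has abscissa at most \<open>(d - 2) / 2\<close>; symmetrically \<open>c\<close> has abscissa at
  least \<open>(d + 2) / 2\<close>.

  If \<open>a\<close> and \<open>c\<close> were more than 2 apart, \<open>a\<close> would have to
  be within 2 of the right tip, hence no farther from the right tip than from the left one, which
  contradicts its abscissa. So they are exactly 2 apart, and the position of \<open>a\<close> is
  determined up to reflection in the horizontal axis: \<open>ax = (d - 2) / 2\<close> and its
  distance from the origin is 2. But then the slices of the left part close to abscissa 1, which
  lie within distance 2 of \<open>(0, 0)\<close> and of \<open>a\<close>, are too short: their
  length is at most about \<open>sqrt 3 + 2 - \<bar>ay\<bar>\<close>, and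
  \<open>\<bar>ay\<bar> > sqrt 3\<close>, while area \<open>pi\<close> would require lengths
  tending to 2 on average.
\<close>
lemma wide_area_less:
  assumes wide: "wide K d"
  shows "emeasure lborel K < ennreal (2 * pi)"
proof (rule ccontr)
  assume "\<not> ?thesis"
  then have area: "emeasure lborel K = ennreal (2 * pi)"
    using wide_area_le[OF wide] by (simp add: not_less)
  note wf = wide_facts[OF wide]
  obtain a where a: "a \<in> K" "fst a \<le> 1" "2 \<le> dist a (d - 2, 0)"
    by (rule wide_tip[OF wide area]) blast
  have area': "emeasure lborel (mirror d -` K) = ennreal (2 * pi)"
    using emeasure_mirror[of K d] wide_parts_borel[OF wide] area by simp
  obtain c' where c': "c' \<in> mirror d -` K" "fst c' \<le> 1" "2 \<le> dist c' (d - 2, 0)"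
      "\<And>z. z \<in> mirror d -` K \<Longrightarrow> 2 < dist z c' \<Longrightarrow> dist z (d - 2, 0) \<le> 2"
    by (rule wide_tip[OF wide_mirror[OF wide] area']) blast
  define c where "c = mirror d c'"
  have mtip: "mirror d (d - 2, 0) = (2, 0)" by (simp add: mirror_def)
  have c: "c \<in> K" "d - 1 \<le> fst c" "2 \<le> dist c (2, 0)"
  proof -
    show "c \<in> K" using c'(1) by (simp add: c_def)
    show "d - 1 \<le> fst c" using c'(2) by (simp add: c_def)
    have "dist c (2, 0) = dist c' (d - 2, 0)"
      unfolding c_def mtip[symmetric] by (rule dist_mirror)
    then show "2 \<le> dist c (2, 0)" using c'(3) by simp
  qed
  have c_far: "dist z (2, 0) \<le> 2" if "z \<in> K" "2 < dist z c" for z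
  proof -
    have "2 < dist (mirror d z) c'" using that(2) unfolding c_def dist_mirror_left .
    then have "dist (mirror d z) (d - 2, 0) \<le> 2" using c'(4)[of "mirror d z"] that(1) by simp
    then show ?thesis unfolding dist_mirror_left mtip .
  qed
  have a0: "dist (0, 0) a \<le> 2"
  proof -
    have "2 < \<bar>fst (d, 0::real) - fst a\<bar>" using a(2) wf(5) by simp
    then have "2 < dist (d, 0) a" using dist_fst_ge[of "(d, 0)" a] by linarith
    then show ?thesis using wide_cover[OF wide a(1)] by simp
  qed
  have cd: "dist (d, 0) c \<le> 2"
  proof -
    have "2 < \<bar>fst (0::real, 0::real) - fst c\<bar>" using c(2) wf(5) by simp
    then have "2 < dist (0, 0) c" using dist_fst_ge[of "(0, 0)" c] by linarith
    then show ?thesis using wide_cover[OF wide c(1)] by simp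
  qed
  have ge: "4 \<le> (fst z - u)\<^sup>2 + (snd z)\<^sup>2" if "2 \<le> dist z (u, 0)" for z :: "real \<times> real" and u
  proof -
    have "2\<^sup>2 \<le> (dist z (u, 0))\<^sup>2" using that by (intro power_mono) auto
    then show ?thesis by (simp add: dist_prod_def dist_real_def)
  qed
  define ax ay cx cy where "ax = fst a" "ay = snd a" "cx = fst c" "cy = snd c"
  have a1: "ax\<^sup>2 + ay\<^sup>2 \<le> 4" using a0 by (simp add: dist_plane_le_iff ax_ay_cx_cy_def)
  have c1: "(d - cx)\<^sup>2 + cy\<^sup>2 \<le> 4" using cd by (simp add: dist_plane_le_iff ax_ay_cx_cy_def)
  have a2: "4 \<le> (ax - (d - 2))\<^sup>2 + ay\<^sup>2" using ge[OF a(3)] by (simp add: ax_ay_cx_cy_def)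
  have c2: "4 \<le> (cx - 2)\<^sup>2 + cy\<^sup>2" using ge[OF c(3)] by (simp add: ax_ay_cx_cy_def)
  have d2: "0 < d - 2" using wf(5) by simp
  have ax: "ax \<le> (d - 2) / 2"
  proof -
    have "(d - 2) * (2 * ax) \<le> (d - 2) * (d - 2)" using a1 a2 by (simp add: power2_eq_square algebra_simps)
    then have "2 * ax \<le> d - 2" using d2 by (simp only: mult_le_cancel_left_pos)
    then show ?thesis by simp
  qed
  have cx: "(d + 2) / 2 \<le> cx"
  proof -
    have "(d - 2) * (d + 2) \<le> (d - 2) * (2 * cx)" using c1 c2 by (simp add: power2_eq_square algebra_simps)
    then have "d + 2 \<le> 2 * cx" using d2 by (simp only: mult_le_cancel_left_pos)
    then show ?thesis by simp
  qed
  have ac: "dist a c \<le> 2"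
  proof (rule ccontr)
    assume "\<not> ?thesis"
    then have "dist a (2, 0) \<le> 2" using c_far[OF a(1)] by simp
    then have "(ax - 2)\<^sup>2 + ay\<^sup>2 \<le> 4" by (simp add: dist_plane_le_iff ax_ay_cx_cy_def)
    then have "(4 - d) * d \<le> (4 - d) * (2 * ax)" using a2 by (simp add: power2_eq_square algebra_simps)
    then have "d \<le> 2 * ax" using wf(6) by (simp only: mult_le_cancel_left_pos diff_gt_0_iff_gt)
    then show False using ax by simp
  qed
  have ax_eq: "ax = (d - 2) / 2"
  proof -
    have "\<bar>ax - cx\<bar> \<le> 2" using dist_fst_ge[of a c] ac by (simp add: ax_ay_cx_cy_def)
    then show ?thesis using ax cx by argo
  qed
  have ay2: "ay\<^sup>2 = 4 - ((d - 2) / 2)\<^sup>2"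
    using a1 a2 unfolding ax_eq by (simp add: power2_eq_square field_simps)
  have "3 < ay\<^sup>2"
  proof -
    have "((d - 2) / 2)\<^sup>2 < 1\<^sup>2" using d2 wf(6) by (intro power_strict_mono) auto
    then show ?thesis unfolding ay2 by simp
  qed
  then have "sqrt 3 < sqrt (ay\<^sup>2)" by (rule real_sqrt_less_mono)
  then have \<kappa>: "0 < \<bar>ay\<bar> - sqrt 3" by simp
  have ay_le: "\<bar>ay\<bar> \<le> 2"
  proof -
    have "ay\<^sup>2 \<le> 4" using a1 zero_le_power2[of ax] by linarith
    then show ?thesis using abs_le_square_iff[of ay 2] by simp
  qed
  let ?X = "left_part K d"
  have slice_le: "len ?X x \<le> sqrt (4 - x\<^sup>2) + 2 - \<bar>ay\<bar>" if x: "0 \<le> x" "x \<le> 113 / 100" for x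
    unfolding len_def
  proof (rule measure_real_le_range)
    have x2: "x\<^sup>2 \<le> 4" using power_mono[of x 2 2] x by simp
    have y: "\<bar>y\<bar> \<le> sqrt (4 - x\<^sup>2) \<and> \<bar>y - ay\<bar> \<le> 2" if "y \<in> slice ?X x" for y
    proof
      have z: "(x, y) \<in> K" "dist (0, 0) (x, y) \<le> 2" using that by (auto simp: slice_def left_part_def)
      then show "\<bar>y\<bar> \<le> sqrt (4 - x\<^sup>2)" by (intro real_le_rsqrt) (simp add: dist_plane_le_iff)
      have "2 < \<bar>fst (d, 0::real) - fst (x, y)\<bar>" using x wf(5) by simp
      then have 1: "2 < dist (d, 0) (x, y)" using dist_fst_ge[of "(d, 0)" "(x, y)"] by linarith
      have "2 < \<bar>fst (d, 0::real) - fst a\<bar>" using a(2) wf(5) by simp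
      then have 2: "2 < dist (d, 0) a" using dist_fst_ge[of "(d, 0)" a] by linarith
      have "dist (x, y) a \<le> 2" by (rule wide_near_left[OF wide z(1) a(1) 1 2])
      moreover have "dist y (snd a) \<le> dist (x, y) a" using dist_snd_le[of "(x, y)" a] by simp
      ultimately show "\<bar>y - ay\<bar> \<le> 2" by (simp add: dist_real_def ax_ay_cx_cy_def)
    qed
    show "y' - y \<le> sqrt (4 - x\<^sup>2) + 2 - \<bar>ay\<bar>" if "y \<in> slice ?X x" "y' \<in> slice ?X x" for y y'
      using y[OF that(1)] y[OF that(2)] by linarith
    have "0 \<le> sqrt (4 - x\<^sup>2)" using x2 by simp
    then show "0 \<le> sqrt (4 - x\<^sup>2) + 2 - \<bar>ay\<bar>" using ay_le by linarith
  qed (use wide_parts_borel[OF wide] in auto)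
  \<comment> \<open>For \<open>t < 13 / 100\<close> the lines \<open>1 - t\<close> and \<open>1 + t\<close> are more than 2 to the left of \<open>(d, 0)\<close>.\<close>
  define \<epsilon> where "\<epsilon> = min (13 / 100) ((\<bar>ay\<bar> - sqrt 3) / 2)"
  have "0 < \<epsilon>" using \<kappa> by (simp add: \<epsilon>_def)
  then obtain t where t: "0 < t" "t < \<epsilon>" "len ?X (1 - t) + len ?X (1 + t) = 4 * sqrt (1 - t\<^sup>2)"
    using left_near_area_eq_middle[OF wide_parts_borel(2)[OF wide] left_part_bounds(1,2)[OF wide]
        left_part_near[OF wide] left_part_bounds(3)[OF wide] wide_area_eq_parts(1)[OF wide area]] by blast
  have t': "t < 13 / 100" "t < (\<bar>ay\<bar> - sqrt 3) / 2" using t(2) by (simp_all add: \<epsilon>_def)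
  have tt: "t\<^sup>2 \<le> t" using t(1) t'(1) by (simp add: power2_eq_square mult_left_le)
  have "1 - t\<^sup>2 \<le> sqrt (1 - t\<^sup>2)"
  proof (rule real_le_rsqrt)
    have "(1 - t\<^sup>2) * (1 - t\<^sup>2) \<le> (1 - t\<^sup>2) * 1" using tt t'(1) by (intro mult_left_mono) auto
    then show "(1 - t\<^sup>2)\<^sup>2 \<le> 1 - t\<^sup>2" by (simp add: power2_eq_square)
  qed
  moreover have "sqrt (4 - (1 - t)\<^sup>2) + sqrt (4 - (1 + t)\<^sup>2) \<le> 2 * sqrt 3"
  proof -
    have "sqrt (4 - (1 - t)\<^sup>2) + sqrt (4 - (1 + t)\<^sup>2) \<le> sqrt (2 * ((4 - (1 - t)\<^sup>2) + (4 - (1 + t)\<^sup>2)))"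
    proof (rule real_le_rsqrt)
      have "(1 - t)\<^sup>2 \<le> 2\<^sup>2" "(1 + t)\<^sup>2 \<le> 2\<^sup>2" using t(1) t'(1) by (intro power_mono; simp)+
      then show "(sqrt (4 - (1 - t)\<^sup>2) + sqrt (4 - (1 + t)\<^sup>2))\<^sup>2 \<le> 2 * ((4 - (1 - t)\<^sup>2) + (4 - (1 + t)\<^sup>2))"
        using sum_squares_bound[of "sqrt (4 - (1 - t)\<^sup>2)" "sqrt (4 - (1 + t)\<^sup>2)"] by (simp add: power2_sum)
    qed
    also have "\<dots> \<le> sqrt (2\<^sup>2 * 3)"
      by (rule real_sqrt_le_mono) (simp add: power2_eq_square algebra_simps)
    also have "\<dots> = 2 * sqrt 3" unfolding real_sqrt_mult by simp
    finally show ?thesis .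
  qed
  moreover have "len ?X (1 - t) \<le> sqrt (4 - (1 - t)\<^sup>2) + 2 - \<bar>ay\<bar>"
    "len ?X (1 + t) \<le> sqrt (4 - (1 + t)\<^sup>2) + 2 - \<bar>ay\<bar>"
    using t(1) t'(1) by (intro slice_le; simp)+
  ultimately show False
    using t(3) t' tt by argo
qed

section \<open>Orthonormal frames\<close>

definition rot :: "real^2 \<Rightarrow> real^2" where
  "rot u = vector [- u $ 2, u $ 1]"

text \<open>
  The orthonormal coordinate system with origin \<open>p\<close> and first axis \<open>u\<close>.
  It carries the statements on slices in \<open>real \<times> real\<close> over to arbitrary
  directions in \<open>real^2\<close>.
\<close>
definition frame :: "real^2 \<Rightarrow> real^2 \<Rightarrow> real \<times> real \<Rightarrow> real^2" where
  "frame p u z = p + fst z *\<^sub>R u + snd z *\<^sub>R rot u"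

lemma inner_plane: "x \<bullet> y = x $ 1 * y $ 1 + x $ 2 * y $ 2" for x y :: "real^2"
  by (simp add: inner_vec_def sum_2)

lemma vec_eq_plane: "x = y \<longleftrightarrow> x $ 1 = y $ 1 \<and> x $ 2 = y $ 2" for x y :: "real^2"
  by (simp add: vec_eq_iff forall_2)

lemma rot_nth [simp]: "rot u $ 1 = - u $ 2" "rot u $ 2 = u $ 1"
  by (simp_all add: rot_def)

lemma rot_simps: "rot (u + v) = rot u + rot v" "rot (u - v) = rot u - rot v" "rot (c *\<^sub>R u) = c *\<^sub>R rot u" "rot (rot u) = - u"
  by (simp_all add: vec_eq_plane)

lemma norm_rot [simp]: "norm (rot u) = norm u"
  by (simp add: norm_eq_sqrt_inner inner_plane)

lemma inner_rot [simp]: "u \<bullet> rot u = 0" "rot u \<bullet> u = 0"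
  by (simp_all add: inner_plane)

lemma norm_frame_combination:
  assumes "norm u = 1"
  shows "norm (a *\<^sub>R u + b *\<^sub>R rot u) = sqrt (a\<^sup>2 + b\<^sup>2)"
proof -
  have "norm (rot u) = 1" using assms by simp
  then have "u \<bullet> u = 1" "rot u \<bullet> rot u = 1" using assms unfolding norm_eq_1 by simp_all
  then have "(a *\<^sub>R u + b *\<^sub>R rot u) \<bullet> (a *\<^sub>R u + b *\<^sub>R rot u) = a\<^sup>2 + b\<^sup>2"
    by (simp add: inner_add_left inner_add_right power2_eq_square)
  then show ?thesis by (simp add: norm_eq_sqrt_inner)
qed

lemma dist_frame [simp]:
  assumes "norm u = 1"
  shows "dist (frame p u z) (frame p u z') = dist z z'"
proof -
  have "frame p u z - frame p u z' = (fst z - fst z') *\<^sub>R u + (snd z - snd z') *\<^sub>R rot u"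
    by (simp add: frame_def algebra_simps)
  then show ?thesis
    by (simp add: dist_norm norm_frame_combination[OF assms])
       (simp add: norm_prod_def)
qed

lemma frame_coordinates:
  assumes "norm u = 1"
  shows "frame p u ((w - p) \<bullet> u, (w - p) \<bullet> rot u) = w"
proof -
  have u: "u $ 1 * u $ 1 + u $ 2 * u $ 2 = 1"
    using assms by (simp add: norm_eq_1 inner_plane)
  have 1: "(a * x + b * y) * x + (b * x - a * y) * (- y) = a * (x * x + y * y)" for a b x y :: real
    by (simp add: algebra_simps)
  have 2: "(a * x + b * y) * y + (b * x - a * y) * x = b * (x * x + y * y)" for a b x y :: real
    by (simp add: algebra_simps)
  show ?thesis
    using 1[of "w $ 1 - p $ 1" "u $ 1" "w $ 2 - p $ 2" "u $ 2"] 2[of "w $ 1 - p $ 1" "u $ 1" "w $ 2 - p $ 2" "u $ 2"]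
    by (simp add: vec_eq_plane frame_def inner_plane u algebra_simps)
qed

lemma vimage_frame_eq_image:
  assumes "norm u = 1"
  shows "frame p u -` S = (\<lambda>w. ((w - p) \<bullet> u, (w - p) \<bullet> rot u)) ` S"
proof
  let ?G = "\<lambda>w. ((w - p) \<bullet> u, (w - p) \<bullet> rot u)"
  have inj: "z = z'" if "frame p u z = frame p u z'" for z z'
    using dist_frame[OF assms, of p z z'] that by simp
  show "frame p u -` S \<subseteq> ?G ` S"
  proof
    fix z assume z: "z \<in> frame p u -` S"
    have "z = ?G (frame p u z)" by (rule inj) (simp only: frame_coordinates[OF assms])
    then show "z \<in> ?G ` S" using z by blast
  qed
  show "?G ` S \<subseteq> frame p u -` S" using frame_coordinates[OF assms] by auto
qed

lemma compact_vimage_frame: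
  assumes "norm u = 1" "compact C" shows "compact (frame p u -` C)"
  unfolding vimage_frame_eq_image[OF assms(1)]
  by (intro compact_continuous_image continuous_intros assms(2))

lemma frame_image_vimage:
  assumes "norm u = 1" shows "frame p u ` (frame p u -` C) = C"
proof -
  have "C \<subseteq> range (frame p u)" using frame_coordinates[OF assms] by (metis rangeI subsetI)
  then show ?thesis by blast
qed

definition vec_of_pair :: "real \<times> real \<Rightarrow> real^2" where
  "vec_of_pair z = vector [fst z, snd z]"

lemma vec_of_pair_nth [simp]: "vec_of_pair z $ 1 = fst z" "vec_of_pair z $ 2 = snd z"
  by (simp_all add: vec_of_pair_def)

lemma continuous_vec_of_pair: "continuous_on S vec_of_pair"
proof -
  have eq: "vec_of_pair = (\<lambda>z. fst z *\<^sub>R axis 1 1 + snd z *\<^sub>R axis 2 1)"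
    by (auto simp: vec_eq_plane axis_def fun_eq_iff)
  show ?thesis unfolding eq by (intro continuous_intros)
qed

lemma distr_vec_of_pair: "lborel = distr lborel borel vec_of_pair"
proof (rule lborel_eqI)
  fix l u :: "real^2" assume le: "\<And>b. b \<in> Basis \<Longrightarrow> l \<bullet> b \<le> u \<bullet> b"
  have lu: "l $ 1 \<le> u $ 1" "l $ 2 \<le> u $ 2"
    using le[of "axis 1 1"] le[of "axis 2 1"] by (simp_all add: inner_axis)
  have "vec_of_pair -` box l u = box (l $ 1) (u $ 1) \<times> box (l $ 2) (u $ 2)"
    by (auto simp: mem_box_cart forall_2)
  then have "emeasure (distr lborel borel vec_of_pair) (box l u)
      = emeasure (lborel \<Otimes>\<^sub>M lborel) (box (l $ 1) (u $ 1) \<times> box (l $ 2) (u $ 2))"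
    using borel_measurable_continuous_onI[OF continuous_vec_of_pair]
    by (subst emeasure_distr) (auto simp: lborel_prod)
  also have "\<dots> = ennreal (u $ 1 - l $ 1) * ennreal (u $ 2 - l $ 2)"
    using lu by (subst lborel.emeasure_pair_measure_Times) (auto simp: box_real)
  also have "\<dots> = ennreal ((u $ 1 - l $ 1) * (u $ 2 - l $ 2))"
    using lu by (simp add: ennreal_mult)
  also have "(u $ 1 - l $ 1) * (u $ 2 - l $ 2) = (\<Prod>b\<in>Basis. (u - l) \<bullet> b)"
  proof -
    have "(Basis :: (real^2) set) = {axis 1 1, axis 2 1}" by (auto simp: Basis_vec_def UNIV_2)
    then have "(\<Prod>b\<in>Basis. (u - l) \<bullet> b) = (\<Prod>b\<in>{axis 1 1, axis 2 1}. (u - l) \<bullet> b)"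
      by (rule arg_cong)
    then show ?thesis by (simp add: axis_eq_axis inner_axis)
  qed
  finally show "emeasure (distr lborel borel vec_of_pair) (box l u) = (\<Prod>b\<in>Basis. (u - l) \<bullet> b)" .
qed simp

text \<open>
  A frame is a translation after an orthogonal map after the identification of
  \<open>real \<times> real\<close> with \<open>real^2\<close>, and each of the three preserves
  areas.
\<close>
lemma emeasure_vimage_frame:
  assumes u: "norm u = 1" and C: "compact C"
  shows "emeasure lborel (frame p u -` C) = emeasure lborel C"
proof -
  let ?K = "frame p u -` C"
  let ?R = "\<lambda>w :: real^2. w $ 1 *\<^sub>R u + w $ 2 *\<^sub>R rot u"
  have K: "compact ?K" by (rule compact_vimage_frame[OF u C])
  have cB: "compact (vec_of_pair ` ?K)"
    by (rule compact_continuous_image[OF continuous_vec_of_pair K])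
  have inj: "vec_of_pair -` (vec_of_pair ` ?K) = ?K"
    by (rule inj_vimage_image_eq) (auto simp: inj_def vec_eq_plane prod_eq_iff)
  have "emeasure lborel (vec_of_pair ` ?K) = emeasure (distr lborel borel vec_of_pair) (vec_of_pair ` ?K)"
    by (subst distr_vec_of_pair) simp
  also have "\<dots> = emeasure lborel ?K"
    using borel_measurable_continuous_onI[OF continuous_vec_of_pair] borel_compact[OF cB]
    by (subst emeasure_distr) (auto simp: inj)
  finally have 1: "emeasure lborel (vec_of_pair ` ?K) = emeasure lborel ?K" .
  have lin: "linear ?R" by (intro linearI) (simp_all add: algebra_simps)
  have orth: "orthogonal_transformation ?R"
    unfolding orthogonal_transformation norm_frame_combination[OF u] using lin
    by (simp add: norm_eq_sqrt_inner inner_plane power2_eq_square)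
  have "C = (+) p ` (?R ` (vec_of_pair ` ?K))"
  proof -
    have "(+) p ` (?R ` (vec_of_pair ` ?K)) = frame p u ` ?K"
      unfolding image_image frame_def[abs_def] vec_of_pair_nth add.assoc ..
    then show ?thesis unfolding frame_image_vimage[OF u] by (rule sym)
  qed
  then have "measure lebesgue C = measure lebesgue ((+) p ` (?R ` (vec_of_pair ` ?K)))"
    by (rule arg_cong)
  also have "\<dots> = measure lebesgue (?R ` (vec_of_pair ` ?K))"
    by (rule measure_translation)
  also have "\<dots> = measure lebesgue (vec_of_pair ` ?K)"
    by (rule measure_orthogonal_image[OF orth lmeasurable_compact[OF cB]])
  finally have 2: "measure lebesgue C = measure lebesgue (vec_of_pair ` ?K)" .
  have fin: "emeasure lborel S = ennreal (measure lebesgue S)" if "compact S" for S :: "(real^2) set"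
  proof -
    have "emeasure lborel S < \<infinity>" by (rule emeasure_bounded_finite[OF compact_imp_bounded[OF that]])
    then have "emeasure lborel S = ennreal (measure lborel S)"
      by (simp add: emeasure_eq_ennreal_measure top.not_eq_extremum)
    then show ?thesis using borel_compact[OF that] by simp
  qed
  show ?thesis using 1 2 fin[OF C] fin[OF cB] by simp
qed

lemma diametral_frame:
  assumes "compact C" "C \<noteq> {}"
  obtains p u d where "norm u = 1" "p \<in> C" "(0, 0) \<in> frame p u -` C" "(d, 0) \<in> frame p u -` C" "0 \<le> d"
    "\<And>x y. x \<in> C \<Longrightarrow> y \<in> C \<Longrightarrow> dist x y \<le> d"
proof -
  obtain p q where pq: "p \<in> C" "q \<in> C" "dist p q = diameter C"
    using diameter_compact_attained[OF assms] by blast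
  obtain u where u: "norm u = 1" "q = p + dist p q *\<^sub>R u"
  proof (cases "p = q")
    case True
    then show ?thesis using that[of "axis 1 1"] by (simp add: norm_axis_1)
  next
    case False
    then show ?thesis using that[of "(q - p) /\<^sub>R dist p q"] by (simp add: dist_norm norm_minus_commute)
  qed
  have "dist x y \<le> dist p q" if "x \<in> C" "y \<in> C" for x y
    unfolding pq(3) by (rule diameter_bounded_bound[OF compact_imp_bounded[OF assms(1)] that])
  then show ?thesis
    using pq(1,2) u by (intro that[of u p "dist p q"]) (auto simp: frame_def)
qed

lemma vimage_frame_dist:
  assumes "norm u = 1" "\<And>x y. x \<in> C \<Longrightarrow> y \<in> C \<Longrightarrow> dist x y \<le> d" "z \<in> frame p u -` C" "z' \<in> frame p u -` C"
  shows "dist z z' \<le> d"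
  using assms(2)[of "frame p u z" "frame p u z'"] assms(1,3,4) by simp

section \<open>The isodiametric inequality\<close>

lemma isodiametric_diameter:
  assumes "norm u = 1" "compact C" "(0, 0) \<in> frame p u -` C" "(d, 0) \<in> frame p u -` C" "0 \<le> d"
    "\<And>x y. x \<in> C \<Longrightarrow> y \<in> C \<Longrightarrow> dist x y \<le> d"
  shows "emeasure lborel C \<le> ennreal (pi * (d / 2)\<^sup>2)"
proof -
  let ?K = "frame p u -` C"
  note diam = vimage_frame_dist[OF assms(1,6)]
  have "emeasure lborel ?K \<le> ennreal (pi * (d / 2)\<^sup>2)"
    by (rule isodiametric_diametral)
       (use diam assms borel_compact[OF compact_vimage_frame[OF assms(1,2)]] in auto)
  then show ?thesis by (simp add: emeasure_vimage_frame[OF assms(1,2)])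
qed

theorem isodiametric_unit:
  assumes C: "compact C" and diam: "\<And>x y. x \<in> C \<Longrightarrow> y \<in> C \<Longrightarrow> dist x y \<le> 2"
  shows "emeasure lborel (C :: (real^2) set) \<le> ennreal pi"
proof (cases "C = {}")
  case False
  then obtain p u d where f: "norm u = 1" "(0, 0) \<in> frame p u -` C" "(d, 0) \<in> frame p u -` C" "0 \<le> d"
    "\<And>x y. x \<in> C \<Longrightarrow> y \<in> C \<Longrightarrow> dist x y \<le> d"
    by (rule diametral_frame[OF C]) blast
  have d2: "d \<le> 2" using vimage_frame_dist[OF f(1) diam f(2,3)] f(4) by (simp add: dist_Pair_Pair)
  have "emeasure lborel C \<le> ennreal (pi * (d / 2)\<^sup>2)"
    by (rule isodiametric_diameter[OF f(1) C f(2-5)])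
  also have "\<dots> \<le> ennreal (pi * 1)"
    using f(4) d2 by (intro ennreal_leI mult_left_mono power_le_one) auto
  finally show ?thesis by simp
qed simp

section \<open>Equality in the isodiametric inequality\<close>

lemma convex_slice_nonempty:
  fixes H :: "(real \<times> real) set"
  assumes "convex H" "z \<in> H" "z' \<in> H" "fst z \<le> x" "x \<le> fst z'"
  shows "slice H x \<noteq> {}"
proof -
  have "convex (fst ` H)" by (rule convex_linear_image[OF linear_fst assms(1)])
  then have "closed_segment (fst z) (fst z') \<subseteq> fst ` H"
    using assms(2,3) by (simp add: closed_segment_subset)
  moreover have "x \<in> closed_segment (fst z) (fst z')" using assms(4,5) by (simp add: closed_segment_eq_real_ivl)
  ultimately obtain w where "w \<in> H" "fst w = x" by blast
  then show ?thesis by (auto simp: slice_def intro: exI[of _ "snd w"])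
qed

lemma slice_extremes:
  assumes H: "compact H" and ne: "slice H x \<noteq> {}"
  obtains \<alpha> \<beta> where "(x, \<alpha>) \<in> H" "(x, \<beta>) \<in> H" "\<And>y. (x, y) \<in> H \<Longrightarrow> \<alpha> \<le> y \<and> y \<le> \<beta>"
    "len H x \<le> \<beta> - \<alpha>"
proof -
  have "slice H x = snd ` (H \<inter> ({x} \<times> UNIV))" by (force simp: slice_def)
  moreover have "compact (H \<inter> ({x} \<times> UNIV))"
    by (intro compact_Int_closed H closed_Times) auto
  ultimately have S: "compact (slice H x)" by (simp add: compact_continuous_image continuous_on_snd)
  obtain \<alpha> where a: "\<alpha> \<in> slice H x" "\<And>y. y \<in> slice H x \<Longrightarrow> \<alpha> \<le> y"
    using compact_attains_inf[OF S ne] by blast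
  obtain \<beta> where b: "\<beta> \<in> slice H x" "\<And>y. y \<in> slice H x \<Longrightarrow> y \<le> \<beta>"
    using compact_attains_sup[OF S ne] by blast
  have "len H x \<le> \<beta> - \<alpha>" unfolding len_def
  proof (rule measure_real_le_range)
    show "y' - y \<le> \<beta> - \<alpha>" if "y \<in> slice H x" "y' \<in> slice H x" for y y'
      using a(2)[OF that(1)] b(2)[OF that(2)] by simp
  qed (use a b borel_compact[OF S] in auto)
  then show ?thesis using that a b by (auto simp: slice_def)
qed

text \<open>
  With area \<open>pi\<close> there are slices at \<open>x - t\<close> and \<open>x + t\<close>,
  with \<open>t\<close> as small as desired, whose total length is
  \<open>4 * sqrt (1 - t\<^sup>2)\<close>. The midpoints of their upper and of their lower ends
  lie in the slice at \<open>x\<close>, by convexity, at distance at least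
  \<open>2 * sqrt (1 - t\<^sup>2)\<close> from each other.
\<close>
lemma isodiametric_equality_chord:
  fixes H :: "(real \<times> real) set"
  assumes H: "compact H" "convex H" and diam: "\<And>z z'. z \<in> H \<Longrightarrow> z' \<in> H \<Longrightarrow> dist z z' \<le> 2"
    and area: "emeasure lborel H = ennreal pi"
  obtains x m where "(x, m - 1) \<in> H" "(x, m + 1) \<in> H" "\<And>z. z \<in> H \<Longrightarrow> \<bar>fst z - x\<bar> \<le> 1"
proof -
  have ne: "H \<noteq> {}" using area by auto
  have cont: "continuous_on H fst" by (rule continuous_on_fst) (rule continuous_on_id)
  obtain zl where zl: "zl \<in> H" "\<And>z. z \<in> H \<Longrightarrow> fst zl \<le> fst z"
    using continuous_attains_inf[OF H(1) ne cont] by blast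
  obtain zr where zr: "zr \<in> H" "\<And>z. z \<in> H \<Longrightarrow> fst z \<le> fst zr"
    using continuous_attains_sup[OF H(1) ne cont] by blast
  define x where "x = (fst zl + fst zr) / 2"
  define w where "w = (fst zr - fst zl) / 2"
  have "fst zr - fst zl \<le> 2" using dist_fst_ge[of zr zl] diam[OF zr(1) zl(1)] by linarith
  then have w1: "w \<le> 1" by (simp add: w_def)
  have in_w: "\<bar>fst z - x\<bar> \<le> w" if "z \<in> H" for z
    using zl(2)[OF that] zr(2)[OF that] by (simp add: x_def w_def abs_le_iff field_simps)
  have in_1: "\<bar>fst z - x\<bar> \<le> 1" if "z \<in> H" for z using in_w[OF that] w1 by linarith
  have nonempty: "slice H (x - t) \<noteq> {} \<and> slice H (x + t) \<noteq> {}" if "0 \<le> t" "t \<le> w" for t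
    using that by (intro conjI convex_slice_nonempty[OF H(2) zl(1) zr(1)]) (auto simp: x_def w_def field_simps)
  have zero: "len H (x - t) + len H (x + t) = 0" if "0 < t" "w < t" for t
  proof -
    have "slice H (x - t) = {}" "slice H (x + t) = {}"
      using in_w[of "(x - t, _)"] in_w[of "(x + t, _)"] that by (auto simp: slice_def)
    then show ?thesis by (simp add: len_empty)
  qed
  have Hb: "H \<in> sets borel" by (rule borel_compact[OF H(1)])
  have le: "len H (x - t) + len H (x + t) \<le> 4 * sqrt (1\<^sup>2 - t\<^sup>2)" if t: "0 < t" "t < 1" for t
  proof (cases "t \<le> w")
    case True
    have "len H (x - t) + len H (x + t) \<le> 2 * sqrt (2\<^sup>2 - ((x - t) - (x + t))\<^sup>2)"
      by (rule len_pair_le[OF Hb]) (use nonempty[of t] True t diam in auto)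
    also have "((x - t) - (x + t))\<^sup>2 = (2 * t)\<^sup>2" by (simp add: power2_eq_square)
    also have "2 * sqrt (2\<^sup>2 - (2 * t)\<^sup>2) = 4 * sqrt (1\<^sup>2 - t\<^sup>2)"
      using sqrt_diff_scale[of 1 t] by simp
    finally show ?thesis .
  next
    case False
    have "t\<^sup>2 \<le> 1" using t by (simp add: power_le_one)
    then show ?thesis using zero[of t] False t by simp
  qed
  have ne0: "slice H x \<noteq> {}"
    by (rule convex_slice_nonempty[OF H(2) zl(1) zr(1)]) (use zl(2)[OF zr(1)] in \<open>auto simp: x_def\<close>)
  obtain \<alpha> \<beta> where ab: "(x, \<alpha>) \<in> H" "(x, \<beta>) \<in> H" and top: "\<And>y. (x, y) \<in> H \<Longrightarrow> \<alpha> \<le> y \<and> y \<le> \<beta>"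
    by (rule slice_extremes[OF H(1) ne0]) blast
  have width: "2 \<le> \<beta> - \<alpha>"
  proof (rule ccontr)
    assume "\<not> ?thesis"
    then have pos: "0 < min 1 ((2 - (\<beta> - \<alpha>)) / 2)" by simp
    have ae: "AE t in lborel. 0 < t \<longrightarrow> t < 1 \<longrightarrow> len H (x - t) + len H (x + t) \<le> 4 * sqrt (1\<^sup>2 - t\<^sup>2)"
      by (intro always_eventually allI impI le)
    have area1: "emeasure lborel H = ennreal (pi * 1\<^sup>2)" by (simp add: area)
    obtain t where t: "0 < t" "t < min 1 ((2 - (\<beta> - \<alpha>)) / 2)"
        "len H (x - t) + len H (x + t) = 4 * sqrt (1\<^sup>2 - t\<^sup>2)"
      by (rule strip_area_eq[OF Hb compact_imp_bounded[OF H(1)] zero_le_one in_1 ae area1 order_refl pos min.cobounded1]) blast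
    have t1: "t < 1" "t < (2 - (\<beta> - \<alpha>)) / 2" using t(2) by auto
    have tt: "t\<^sup>2 \<le> t" using t(1) t1(1) by (simp add: power2_eq_square mult_left_le)
    have "0 < sqrt (1\<^sup>2 - t\<^sup>2)" using tt t1 by simp
    then have "t \<le> w" using zero[of t] t(1,3) by (cases "t \<le> w") auto
    then have ne2: "slice H (x - t) \<noteq> {}" "slice H (x + t) \<noteq> {}" using nonempty[of t] t(1) by auto
    obtain \<alpha>1 \<beta>1 where 1: "(x - t, \<alpha>1) \<in> H" "(x - t, \<beta>1) \<in> H" "len H (x - t) \<le> \<beta>1 - \<alpha>1"
      by (rule slice_extremes[OF H(1) ne2(1)]) blast
    obtain \<alpha>2 \<beta>2 where 2: "(x + t, \<alpha>2) \<in> H" "(x + t, \<beta>2) \<in> H" "len H (x + t) \<le> \<beta>2 - \<alpha>2"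
      by (rule slice_extremes[OF H(1) ne2(2)]) blast
    have mid: "(x, (y + y') / 2) \<in> H" if "(x - t, y) \<in> H" "(x + t, y') \<in> H" for y y'
    proof -
      have "(1 / 2) *\<^sub>R (x - t, y) + (1 / 2) *\<^sub>R (x + t, y') \<in> H"
        by (rule convexD[OF H(2) that]) auto
      then show ?thesis by (simp add: field_simps)
    qed
    have "1 - t\<^sup>2 \<le> sqrt (1\<^sup>2 - t\<^sup>2)"
    proof (rule real_le_rsqrt)
      have "(1 - t\<^sup>2) * (1 - t\<^sup>2) \<le> (1 - t\<^sup>2) * 1" using tt t1 by (intro mult_left_mono) auto
      then show "(1 - t\<^sup>2)\<^sup>2 \<le> 1\<^sup>2 - t\<^sup>2" by (simp add: power2_eq_square)
    qed
    moreover have "4 * sqrt (1\<^sup>2 - t\<^sup>2) \<le> (\<beta>1 - \<alpha>1) + (\<beta>2 - \<alpha>2)" using t(3) 1(3) 2(3) by linarith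
    moreover have "\<alpha> \<le> (\<alpha>1 + \<alpha>2) / 2" "(\<beta>1 + \<beta>2) / 2 \<le> \<beta>"
      using top[OF mid[OF 1(1) 2(1)]] top[OF mid[OF 1(2) 2(2)]] by blast+
    ultimately show False using tt t1(2) by argo
  qed
  moreover have "\<beta> - \<alpha> \<le> 2" using diam[OF ab(2,1)] by (simp add: dist_Pair_Pair dist_real_def)
  ultimately have "\<beta> = \<alpha> + 2" by simp
  then show ?thesis using ab in_1 by (intro that[of x "\<alpha> + 1"]) (auto simp: add.commute)
qed

text \<open>
  The chord of length 2 in the direction \<open>rot u\<close> bisects the width of
  \<open>H\<close> in the direction \<open>u\<close>, and vice versa; so the two chords bisect
  each other.
\<close>
lemma isodiametric_equality_cross:
  fixes H :: "(real^2) set"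
  assumes H: "compact H" "convex H" and diam: "\<And>x y. x \<in> H \<Longrightarrow> y \<in> H \<Longrightarrow> dist x y \<le> 2"
    and area: "emeasure lborel H = ennreal pi" and u: "norm u = 1"
  obtains c where "c + u \<in> H" "c - u \<in> H" "c + rot u \<in> H" "c - rot u \<in> H"
proof -
  have cvx: "convex (frame 0 v -` H)" for v
  proof -
    have "linear (frame 0 v)" by (intro linearI) (simp_all add: frame_def algebra_simps)
    then show ?thesis by (rule convex_linear_vimage[OF _ H(2)])
  qed
  have v: "norm (rot u) = 1" using u by simp
  obtain x m where 1: "(x, m - 1) \<in> frame 0 u -` H" "(x, m + 1) \<in> frame 0 u -` H"
      "\<And>z. z \<in> frame 0 u -` H \<Longrightarrow> \<bar>fst z - x\<bar> \<le> 1"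
    by (rule isodiametric_equality_chord[OF compact_vimage_frame[OF u H(1)] cvx vimage_frame_dist[OF u diam]])
       (use area emeasure_vimage_frame[OF u H(1)] in auto)
  obtain y n where 2: "(y, n - 1) \<in> frame 0 (rot u) -` H" "(y, n + 1) \<in> frame 0 (rot u) -` H"
      "\<And>z. z \<in> frame 0 (rot u) -` H \<Longrightarrow> \<bar>fst z - y\<bar> \<le> 1"
    by (rule isodiametric_equality_chord[OF compact_vimage_frame[OF v H(1)] cvx vimage_frame_dist[OF v diam]])
       (use area emeasure_vimage_frame[OF v H(1)] in auto)
  have sw: "frame 0 (rot u) (a, b) = frame 0 u (- b, a)" for a b
    by (simp add: frame_def rot_simps)
  have "\<bar>- (n - 1) - x\<bar> \<le> 1" "\<bar>- (n + 1) - x\<bar> \<le> 1"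
    using 1(3)[of "(- (n - 1), y)"] 1(3)[of "(- (n + 1), y)"] 2(1,2) by (simp_all add: sw)
  then have n: "n = - x" by linarith
  have "\<bar>(m - 1) - y\<bar> \<le> 1" "\<bar>(m + 1) - y\<bar> \<le> 1"
    using 2(3)[of "(m - 1, - x)"] 2(3)[of "(m + 1, - x)"] 1(1,2) by (simp_all add: sw)
  then have m: "y = m" by linarith
  show ?thesis
  proof (rule that[of "frame 0 u (x, m)"])
    have "frame 0 u (x, m) + rot u = frame 0 u (x, m + 1)" "frame 0 u (x, m) - rot u = frame 0 u (x, m - 1)"
      by (simp_all add: frame_def algebra_simps)
    then show "frame 0 u (x, m) + rot u \<in> H" "frame 0 u (x, m) - rot u \<in> H" using 1(1,2) by auto
    have "frame 0 u (x, m) + u = frame 0 (rot u) (y, n - 1)" "frame 0 u (x, m) - u = frame 0 (rot u) (y, n + 1)"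
      by (simp_all add: sw n m) (simp_all add: frame_def algebra_simps)
    then show "frame 0 u (x, m) + u \<in> H" "frame 0 u (x, m) - u \<in> H" using 2(1,2) by auto
  qed
qed

text \<open>
  The four distances between an end of one cross and the opposite end of the other are at most 2.
  The chords \<open>2 * u\<close> and \<open>2 * u'\<close> bound the component of
  \<open>c - c'\<close> along \<open>u + u'\<close> to second order in \<open>u - u'\<close>; the
  orthogonal chords do the same for the component orthogonal to \<open>u + u'\<close>.
\<close>
lemma cross_centers_close:
  fixes H :: "(real^2) set"
  assumes diam: "\<And>x y. x \<in> H \<Longrightarrow> y \<in> H \<Longrightarrow> dist x y \<le> 2"
    and u: "norm u = 1" and u': "norm u' = 1" and close: "norm (u - u') \<le> 1"
    and c: "c + u \<in> H" "c - u \<in> H" "c + rot u \<in> H" "c - rot u \<in> H"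
    and c': "c' + u' \<in> H" "c' - u' \<in> H" "c' + rot u' \<in> H" "c' - rot u' \<in> H"
  shows "norm (c - c') \<le> (norm (u - u'))\<^sup>2"
proof -
  define \<Delta> where "\<Delta> = c - c'"
  define e where "e = (norm (u - u'))\<^sup>2"
  have e0: "0 \<le> e" "e \<le> 1" using close by (simp_all add: e_def power_le_one)
  have par: "(norm (v + v'))\<^sup>2 = 4 - (norm (v - v'))\<^sup>2" if "norm v = 1" "norm v' = 1" for v v' :: "real^2"
    using that by (simp add: power2_norm_eq_inner norm_eq_1 inner_add_left inner_add_right inner_diff_left inner_diff_right inner_commute)
  have key: "2 * \<bar>\<Delta> \<bullet> (v + v')\<bar> \<le> (norm (v - v'))\<^sup>2"
    if "norm v = 1" "norm v' = 1" "c + v \<in> H" "c - v \<in> H" "c' + v' \<in> H" "c' - v' \<in> H" for v v'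
  proof -
    have "norm (\<Delta> + (v + v')) \<le> 2" using diam[OF that(3,6)] by (simp add: dist_norm \<Delta>_def algebra_simps)
    then have "(norm (\<Delta> + (v + v')))\<^sup>2 \<le> 2\<^sup>2" by (intro power_mono) auto
    moreover have "norm (\<Delta> - (v + v')) \<le> 2" using diam[OF that(4,5)] by (simp add: dist_norm \<Delta>_def algebra_simps)
    then have "(norm (\<Delta> - (v + v')))\<^sup>2 \<le> 2\<^sup>2" by (intro power_mono) auto
    moreover have "(norm (\<Delta> + (v + v')))\<^sup>2 = (norm \<Delta>)\<^sup>2 + 2 * (\<Delta> \<bullet> (v + v')) + (norm (v + v'))\<^sup>2"
      unfolding power2_norm_eq_inner by (simp add: inner_add_left inner_add_right inner_commute)
    moreover have "(norm (\<Delta> - (v + v')))\<^sup>2 = (norm \<Delta>)\<^sup>2 - 2 * (\<Delta> \<bullet> (v + v')) + (norm (v + v'))\<^sup>2"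
      unfolding power2_norm_eq_inner by (simp add: inner_add_left inner_add_right inner_diff_left inner_diff_right inner_commute)
    ultimately have "(norm \<Delta>)\<^sup>2 + 2 * (\<Delta> \<bullet> (v + v')) + (norm (v + v'))\<^sup>2 \<le> 2\<^sup>2"
      "(norm \<Delta>)\<^sup>2 - 2 * (\<Delta> \<bullet> (v + v')) + (norm (v + v'))\<^sup>2 \<le> 2\<^sup>2" by (simp_all only:)
    moreover have "2 * \<bar>b\<bar> \<le> n" if "a + 2 * b + (4 - n) \<le> 2\<^sup>2" "a - 2 * b + (4 - n) \<le> 2\<^sup>2" "0 \<le> a" for a b n :: real
      using that by (simp add: abs_if)
    ultimately show ?thesis unfolding par[OF that(1,2)] using zero_le_power2 by blast
  qed
  have 1: "2 * \<bar>\<Delta> \<bullet> (u + u')\<bar> \<le> e" unfolding e_def by (rule key[OF u u' c(1,2) c'(1,2)])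
  have "norm (rot u - rot u') = norm (u - u')" by (simp flip: rot_simps)
  then have 2: "2 * \<bar>\<Delta> \<bullet> rot (u + u')\<bar> \<le> e"
    using key[of "rot u" "rot u'"] u u' c c' by (simp add: rot_simps e_def)
  have id: "(norm \<Delta>)\<^sup>2 * (norm (u + u'))\<^sup>2 = (\<Delta> \<bullet> (u + u'))\<^sup>2 + (\<Delta> \<bullet> rot (u + u'))\<^sup>2"
    unfolding power2_norm_eq_inner by (simp add: inner_plane power2_eq_square algebra_simps)
  have sq: "4 * a\<^sup>2 \<le> e\<^sup>2" if "2 * \<bar>a\<bar> \<le> e" for a
  proof -
    have "(2 * \<bar>a\<bar>)\<^sup>2 \<le> e\<^sup>2" using that by (intro power_mono) auto
    then show ?thesis by (simp add: power_mult_distrib)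
  qed
  have "(norm \<Delta>)\<^sup>2 * 3 \<le> (norm \<Delta>)\<^sup>2 * (norm (u + u'))\<^sup>2"
    using par[OF u u'] e0 by (intro mult_left_mono) (auto simp: e_def)
  also have "\<dots> \<le> e\<^sup>2" using sq[OF 1] sq[OF 2] zero_le_power2[of e] unfolding id by linarith
  finally have "(norm \<Delta>)\<^sup>2 \<le> e\<^sup>2" using zero_le_power2[of "norm \<Delta>"] by linarith
  then have "norm \<Delta> \<le> e" by (rule power2_le_imp_le[OF _ e0(1)])
  then show ?thesis by (simp add: \<Delta>_def e_def)
qed

definition unit_vec :: "real \<Rightarrow> real^2" where
  "unit_vec \<theta> = vector [cos \<theta>, sin \<theta>]"

lemma norm_unit_vec [simp]: "norm (unit_vec \<theta>) = 1"
  by (simp add: norm_eq_1 inner_plane unit_vec_def flip: power2_eq_square)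

lemma norm_unit_vec_diff: "norm (unit_vec \<theta> - unit_vec \<phi>) \<le> \<bar>\<theta> - \<phi>\<bar>"
proof -
  have "(norm (unit_vec \<theta> - unit_vec \<phi>))\<^sup>2 = 2 - 2 * cos (\<theta> - \<phi>)"
  proof -
    have "(norm (unit_vec \<theta> - unit_vec \<phi>))\<^sup>2
        = ((cos \<theta>)\<^sup>2 + (sin \<theta>)\<^sup>2) + ((cos \<phi>)\<^sup>2 + (sin \<phi>)\<^sup>2) - 2 * (cos \<theta> * cos \<phi> + sin \<theta> * sin \<phi>)"
      unfolding power2_norm_eq_inner inner_plane unit_vec_def by (simp add: power2_eq_square algebra_simps)
    then show ?thesis by (simp add: cos_diff)
  qed
  also have "\<dots> = (2 * sin ((\<theta> - \<phi>) / 2))\<^sup>2"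
  proof -
    have "cos (2 * ((\<theta> - \<phi>) / 2)) = 1 - 2 * (sin ((\<theta> - \<phi>) / 2))\<^sup>2" by (rule cos_double_sin)
    moreover have "2 * ((\<theta> - \<phi>) / 2) = \<theta> - \<phi>" by simp
    ultimately have "cos (\<theta> - \<phi>) = 1 - 2 * (sin ((\<theta> - \<phi>) / 2))\<^sup>2" by (simp only:)
    then show ?thesis by (simp add: power_mult_distrib)
  qed
  also have "\<dots> \<le> (\<theta> - \<phi>)\<^sup>2"
  proof -
    have "\<bar>2 * sin ((\<theta> - \<phi>) / 2)\<bar> \<le> \<bar>\<theta> - \<phi>\<bar>" using abs_sin_x_le_abs_x[of "(\<theta> - \<phi>) / 2"] by simp
    then show ?thesis by (simp only: abs_le_square_iff)
  qed
  finally have "(norm (unit_vec \<theta> - unit_vec \<phi>))\<^sup>2 \<le> \<bar>\<theta> - \<phi>\<bar>\<^sup>2" by simp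
  then show ?thesis by (rule power2_le_imp_le) simp
qed

lemma unit_vec_surj:
  assumes "norm u = 1" obtains \<theta> where "u = unit_vec \<theta>"
proof -
  have "(u $ 1)\<^sup>2 + (u $ 2)\<^sup>2 = 1" using assms by (simp add: norm_eq_1 inner_plane power2_eq_square)
  then obtain \<theta> where "u $ 1 = cos \<theta>" "u $ 2 = sin \<theta>" using sincos_total_2pi by metis
  then show ?thesis using that[of \<theta>] by (simp add: vec_eq_plane unit_vec_def)
qed

lemma quadratic_continuity_imp_constant:
  fixes f :: "real \<Rightarrow> 'a::real_normed_vector"
  assumes q: "\<And>x y. \<bar>x - y\<bar> \<le> 1 \<Longrightarrow> norm (f x - f y) \<le> \<bar>x - y\<bar>\<^sup>2"
  shows "f x = f y"
proof -
  have "(f has_derivative (\<lambda>h. 0)) (at x within UNIV)" for x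
  proof (rule has_derivativeI_sandwich[where H="\<lambda>y. \<bar>y - x\<bar>" and e=1])
    show "norm (f y - f x - 0) / norm (y - x) \<le> \<bar>y - x\<bar>" if "y \<noteq> x" "dist y x < 1" for y
    proof -
      have "norm (f y - f x) \<le> \<bar>y - x\<bar>\<^sup>2" using q[of y x] that by (simp add: dist_real_def)
      then show ?thesis using that by (simp add: divide_le_eq power2_eq_square)
    qed
    show "((\<lambda>y. \<bar>y - x\<bar>) \<longlongrightarrow> 0) (at x within UNIV)"
      using tendsto_rabs_zero[OF LIM_zero[OF tendsto_ident_at]] by auto
  qed auto
  then obtain c where "\<And>x. f x = c" using has_derivative_zero_constant[of UNIV f] by auto
  then show ?thesis by simp
qed

text \<open>
  The convex hull \<open>H\<close> has the same diameter bound and thus the same area. For every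
  direction it contains a cross of two diameters of length 2; by the quadratic estimate the centre
  of the cross has derivative 0 as a function of the direction, so it is constant. Hence
  \<open>H\<close> contains a full unit circle, and with it the unit disc, which already has the
  area of \<open>H\<close>.
\<close>
theorem isodiametric_unit_equality:
  fixes C :: "(real^2) set"
  assumes C: "compact C" and diam: "\<And>x y. x \<in> C \<Longrightarrow> y \<in> C \<Longrightarrow> dist x y \<le> 2"
    and area: "emeasure lborel C = ennreal pi"
  obtains c where "sym_diff C (cball c 1) \<in> null_sets lborel"
proof -
  define H where "H = convex hull C"
  have H: "compact H" "convex H" by (simp_all add: H_def C compact_convex_hull)
  have CH: "C \<subseteq> H" unfolding H_def by (rule hull_subset)
  have dH: "dist x y \<le> 2" if "x \<in> H" "y \<in> H" for x y
  proof -
    have "H \<subseteq> cball x 2" if "x \<in> C" for x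
      unfolding H_def by (rule hull_minimal) (use diam that in auto)
    then have "C \<subseteq> cball x 2" using \<open>x \<in> H\<close> by (auto simp: dist_commute subset_iff)
    then have "H \<subseteq> cball x 2" unfolding H_def by (rule hull_minimal) simp
    then show ?thesis using \<open>y \<in> H\<close> by auto
  qed
  have aH: "emeasure lborel H = ennreal pi"
  proof (rule antisym)
    show "emeasure lborel H \<le> ennreal pi" by (rule isodiametric_unit[OF H(1) dH])
    show "ennreal pi \<le> emeasure lborel H"
      unfolding area[symmetric] by (rule emeasure_mono[OF CH]) (simp add: borel_compact[OF H(1)])
  qed
  have "\<exists>c. c + unit_vec \<theta> \<in> H \<and> c - unit_vec \<theta> \<in> H \<and> c + rot (unit_vec \<theta>) \<in> H \<and> c - rot (unit_vec \<theta>) \<in> H" for \<theta>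
    by (rule isodiametric_equality_cross[OF H dH aH norm_unit_vec[of \<theta>]]) blast+
  then obtain c where c: "\<And>\<theta>. c \<theta> + unit_vec \<theta> \<in> H" "\<And>\<theta>. c \<theta> - unit_vec \<theta> \<in> H"
    "\<And>\<theta>. c \<theta> + rot (unit_vec \<theta>) \<in> H" "\<And>\<theta>. c \<theta> - rot (unit_vec \<theta>) \<in> H" by metis
  have "norm (c \<theta> - c \<phi>) \<le> \<bar>\<theta> - \<phi>\<bar>\<^sup>2" if "\<bar>\<theta> - \<phi>\<bar> \<le> 1" for \<theta> \<phi>
  proof -
    have le: "norm (unit_vec \<theta> - unit_vec \<phi>) \<le> \<bar>\<theta> - \<phi>\<bar>" by (rule norm_unit_vec_diff)
    then have "norm (c \<theta> - c \<phi>) \<le> (norm (unit_vec \<theta> - unit_vec \<phi>))\<^sup>2"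
      using that by (intro cross_centers_close[OF dH norm_unit_vec norm_unit_vec _ c c]) auto
    also have "\<dots> \<le> \<bar>\<theta> - \<phi>\<bar>\<^sup>2" using le by (intro power_mono) auto
    finally show ?thesis .
  qed
  then have const: "c \<theta> = c 0" for \<theta> by (rule quadratic_continuity_imp_constant)
  define c0 where "c0 = c 0"
  have circle: "c0 + u \<in> H" "c0 - u \<in> H" if "norm u = 1" for u
    using unit_vec_surj[OF that] c(1,2) const unfolding c0_def by metis+
  have BH: "cball c0 1 \<subseteq> H"
  proof
    fix z assume z: "z \<in> cball c0 1"
    define r where "r = norm (z - c0)"
    obtain u where u: "norm u = 1" "z = c0 + r *\<^sub>R u"
    proof (cases "z = c0")
      case True then show ?thesis using that[of "axis 1 1"] by (simp add: r_def norm_axis_1)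
    next
      case False then show ?thesis using that[of "(z - c0) /\<^sub>R r"] by (simp add: r_def)
    qed
    have r: "0 \<le> r" "r \<le> 1" using z by (auto simp: r_def dist_norm norm_minus_commute)
    have "((1 + r) / 2) *\<^sub>R (c0 + u) + ((1 - r) / 2) *\<^sub>R (c0 - u) \<in> H"
      using r by (intro convexD[OF H(2) circle[OF u(1)]]) (auto simp: field_simps)
    moreover have "((1 + r) / 2) *\<^sub>R (c0 + u) + ((1 - r) / 2) *\<^sub>R (c0 - u) = z"
      unfolding u(2) by (simp add: vec_eq_plane field_simps)
    ultimately show "z \<in> H" by simp
  qed
  have null: "H - S \<in> null_sets lborel" if "S \<subseteq> H" "S \<in> sets borel" "emeasure lborel S = ennreal pi" for S
  proof (rule null_setsI)
    have "emeasure lborel (H - S) = emeasure lborel H - emeasure lborel S"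
      using that borel_compact[OF H(1)] by (intro emeasure_Diff) auto
    then show "emeasure lborel (H - S) = 0" using aH that by simp
    show "H - S \<in> sets lborel" using that borel_compact[OF H(1)] by auto
  qed
  have "H - C \<in> null_sets lborel" by (rule null[OF CH borel_compact[OF C] area])
  moreover have "H - cball c0 1 \<in> null_sets lborel"
    by (rule null[OF BH]) (auto simp: emeasure_cball unit_ball_vol_2)
  ultimately have "(H - C) \<union> (H - cball c0 1) \<in> null_sets lborel" by (rule null_sets.Un)
  moreover have "sym_diff C (cball c0 1) \<subseteq> (H - C) \<union> (H - cball c0 1)" using CH BH by blast
  moreover have "sym_diff C (cball c0 1) \<in> sets lborel" using borel_compact[OF C] by auto
  ultimately show ?thesis using that null_sets_subset by blast
qed

section \<open>The area of triangle-free sets\<close>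

lemma triangle_free_area_less_near:
  fixes C :: "(real^2) set"
  assumes C: "compact C" and tf: "triangle_free C" and near: "\<And>x y. x \<in> C \<Longrightarrow> y \<in> C \<Longrightarrow> dist x y < 4"
  shows "emeasure lborel C < ennreal (2 * pi)"
proof (cases "C = {}")
  case False
  then obtain p u d where f: "norm u = 1" "(0, 0) \<in> frame p u -` C" "(d, 0) \<in> frame p u -` C" "0 \<le> d"
    "\<And>x y. x \<in> C \<Longrightarrow> y \<in> C \<Longrightarrow> dist x y \<le> d"
    by (rule diametral_frame[OF C]) blast
  let ?K = "frame p u -` C"
  have diam: "dist z z' \<le> d" if "z \<in> ?K" "z' \<in> ?K" for z z'
    using f(5)[of "frame p u z" "frame p u z'"] f(1) that by simp
  have K: "compact ?K" by (rule compact_vimage_frame[OF f(1) C])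
  have "dist (frame p u (0, 0)) (frame p u (d, 0)) < 4" using near f(2,3) by blast
  then have d4: "d < 4" using f(4) by (simp add: f(1) dist_Pair_Pair)
  have tfK: "triangle_free ?K"
    unfolding triangle_free_def
  proof (intro ballI)
    fix a b c assume "a \<in> ?K" "b \<in> ?K" "c \<in> ?K"
    then have "dist (frame p u a) (frame p u b) \<le> 2 \<or> dist (frame p u a) (frame p u c) \<le> 2 \<or>
        dist (frame p u b) (frame p u c) \<le> 2"
      using tf unfolding triangle_free_def by blast
    then show "dist a b \<le> 2 \<or> dist a c \<le> 2 \<or> dist b c \<le> 2" by (simp only: dist_frame[OF f(1)])
  qed
  have eq: "emeasure lborel ?K = emeasure lborel C" by (rule emeasure_vimage_frame[OF f(1) C])
  consider "d\<^sup>2 < 8" | "8 \<le> d\<^sup>2" "d \<le> 157 / 50" | "157 / 50 < d" by linarith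
  then show ?thesis
  proof cases
    case 1
    have "emeasure lborel C \<le> ennreal (pi * (d / 2)\<^sup>2)"
      by (rule isodiametric_diameter[OF f(1) C f(2-5)])
    also have "\<dots> < ennreal (2 * pi)"
      using 1 by (intro ennreal_lessI) (simp_all add: power_divide)
    finally show ?thesis .
  next
    case 2
    have "emeasure lborel ?K < ennreal (2 * pi)"
      by (rule moderate_diameter_area_less[OF borel_compact[OF K] f(2,3) tfK _ 2]) (rule diam)
    then show ?thesis unfolding eq .
  next
    case 3
    have "0 \<le> fst z \<and> fst z \<le> d" if "z \<in> ?K" for z
      using diam[OF that f(2)] diam[OF that f(3)] dist_fst_ge[of z "(0, 0)"] dist_fst_ge[of z "(d, 0)"] by auto
    then have "wide ?K d" unfolding wide_def using K tfK f(2,3) 3 d4 by auto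
    then have "emeasure lborel ?K < ennreal (2 * pi)" by (rule wide_area_less)
    then show ?thesis unfolding eq .
  qed
qed simp

lemma emeasure_open_pos:
  fixes U :: "'a::euclidean_space set"
  assumes "open U" "U \<noteq> {}"
  shows "0 < emeasure lborel U"
proof (rule ccontr)
  assume "\<not> ?thesis"
  then have "U \<in> null_sets lebesgue" using assms(1) by (intro null_setsI) auto
  then show False using open_not_negligible[OF assms] by (simp add: negligible_iff_null_sets)
qed

lemma emeasure_Diff_plus:
  assumes "U \<subseteq> B" "U \<in> sets M" "B \<in> sets M"
  shows "emeasure M (B - U) + emeasure M U = emeasure M B"
proof -
  have "(B - U) \<union> U = B" using assms(1) by blast
  then show ?thesis using plus_emeasure[of "B - U" M U] assms by auto
qed

lemma emeasure_unit_ball: "emeasure lborel (cball (c :: real^2) 1) = ennreal pi"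
  by (simp add: emeasure_cball unit_ball_vol_2)

lemma dist_closure_le:
  assumes "\<And>x y. x \<in> S \<Longrightarrow> y \<in> S \<Longrightarrow> dist x y \<le> r" "x \<in> closure S" "y \<in> closure S"
  shows "dist x y \<le> r"
proof -
  have "closure S \<subseteq> cball x r" if "x \<in> S" for x
    by (rule closure_minimal) (use assms(1)[OF that] in auto)
  then have "S \<subseteq> cball y r" using assms(3) by (auto simp: dist_commute subset_iff)
  then have "closure S \<subseteq> cball y r" by (rule closure_minimal) simp
  then show ?thesis using assms(2) by (auto simp: dist_commute)
qed

text \<open>
  The discs of radius 2 around \<open>p\<close> and \<open>q\<close> meet in at most one point, so
  up to that point every point of \<open>C\<close> is far from \<open>p\<close> or far from
  \<open>q\<close>. The points far from \<open>p\<close> are pairwise close, and likewise for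
  \<open>q\<close>: \<open>C\<close> is essentially a union of two sets of diameter at most 2.
\<close>
lemma triangle_free_area_far:
  fixes C :: "(real^2) set"
  assumes C: "compact C" and tf: "triangle_free C" and pq: "p \<in> C" "q \<in> C" "4 \<le> dist p q"
  shows "emeasure lborel C \<le> ennreal (2 * pi)"
    and "emeasure lborel C = ennreal (2 * pi) \<Longrightarrow>
      \<exists>b c. sym_diff C (cball b 1 \<union> cball c 1) \<in> null_sets lborel \<and> ball b 1 \<inter> ball c 1 = {}"
proof -
  define P where "P = closure (C - cball q 2)"
  define Q where "Q = closure (C - cball p 2)"
  have far: "2 < dist p q" "2 < dist q p" using pq(3) by (simp_all add: dist_commute)
  have clC: "closed C" by (rule compact_imp_closed[OF C])
  have PC: "P \<subseteq> C" "Q \<subseteq> C" unfolding P_def Q_def by (rule closure_minimal[OF _ clC]; blast)+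
  have cP: "compact P" "compact Q"
  proof -
    have "closed P" "closed Q" by (simp_all add: P_def Q_def)
    then show "compact P" "compact Q"
      using compact_Int_closed[OF C, of P] compact_Int_closed[OF C, of Q] PC by (simp_all add: Int_absorb1)
  qed
  have dP: "dist x y \<le> 2" if "x \<in> P" "y \<in> P" for x y
    using that unfolding P_def
    by (rule dist_closure_le[rotated]) (use triangle_freeD[OF tf pq(2)] in auto)
  have dQ: "dist x y \<le> 2" if "x \<in> Q" "y \<in> Q" for x y
    using that unfolding Q_def
    by (rule dist_closure_le[rotated]) (use triangle_freeD[OF tf pq(1)] in auto)
  define m where "m = (1 / 2) *\<^sub>R (p + q)"
  have cover: "C \<subseteq> P \<union> Q \<union> {m}"
  proof
    fix z assume z: "z \<in> C"
    show "z \<in> P \<union> Q \<union> {m}"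
    proof (cases "dist p z \<le> 2 \<and> dist q z \<le> 2")
      case False
      then show ?thesis using z closure_subset[of "C - cball q 2"] closure_subset[of "C - cball p 2"]
        unfolding P_def Q_def by auto
    next
      case True
      have n: "norm (z - p) \<le> 2" "norm (z - q) \<le> 2"
        using True by (simp_all add: dist_norm norm_minus_commute)
      have "(norm (z - p))\<^sup>2 \<le> 4" "(norm (z - q))\<^sup>2 \<le> 4"
        using power_mono[OF n(1) norm_ge_zero, of 2] power_mono[OF n(2) norm_ge_zero, of 2] by simp_all
      moreover have "16 \<le> (norm (p - q))\<^sup>2"
        using power_mono[OF pq(3), of 2] by (simp add: dist_norm)
      moreover have "(norm ((z - p) + (z - q)))\<^sup>2 + (norm (p - q))\<^sup>2 = 2 * (norm (z - p))\<^sup>2 + 2 * (norm (z - q))\<^sup>2"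
        unfolding power2_norm_eq_inner by (simp add: inner_plane algebra_simps)
      ultimately have "(norm ((z - p) + (z - q)))\<^sup>2 \<le> 0" by linarith
      then have "(z - p) + (z - q) = 0" by simp
      then have "z = m" by (simp add: m_def vec_eq_plane)
      then show ?thesis by simp
    qed
  qed
  have bor: "P \<in> sets borel" "Q \<in> sets borel" "C \<in> sets borel" using cP C by (auto intro: borel_compact)
  have m0: "{m} \<in> null_sets lborel" by (rule null_setsI) auto
  have leP: "emeasure lborel P \<le> ennreal pi" by (rule isodiametric_unit[OF cP(1) dP])
  have leQ: "emeasure lborel Q \<le> ennreal pi" by (rule isodiametric_unit[OF cP(2) dQ])
  have "emeasure lborel C \<le> emeasure lborel (P \<union> Q \<union> {m})"
    by (rule emeasure_mono[OF cover]) (use bor in auto)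
  also have "\<dots> = emeasure lborel (P \<union> Q)" using bor m0 by (intro emeasure_Un_null_set) auto
  also have "\<dots> \<le> emeasure lborel P + emeasure lborel Q" using bor by (intro emeasure_subadditive) auto
  finally have le: "emeasure lborel C \<le> emeasure lborel P + emeasure lborel Q" .
  have "ennreal pi + ennreal pi = ennreal (2 * pi)" by (simp flip: ennreal_plus)
  then show "emeasure lborel C \<le> ennreal (2 * pi)" using le add_mono[OF leP leQ] by (metis order_trans)
  show "\<exists>b c. sym_diff C (cball b 1 \<union> cball c 1) \<in> null_sets lborel \<and> ball b 1 \<inter> ball c 1 = {}"
    if area: "emeasure lborel C = ennreal (2 * pi)"
  proof -
    have areas: "emeasure lborel P = ennreal pi" "emeasure lborel Q = ennreal pi"
      using add_pi_bounds_tight[OF leP leQ] le area by simp_all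
    obtain b where b: "sym_diff P (cball b 1) \<in> null_sets lborel"
      by (rule isodiametric_unit_equality[OF cP(1) dP areas(1)]) auto
    obtain c where c: "sym_diff Q (cball c 1) \<in> null_sets lborel"
      by (rule isodiametric_unit_equality[OF cP(2) dQ areas(2)]) auto
    let ?N = "sym_diff P (cball b 1) \<union> sym_diff Q (cball c 1) \<union> {m}"
    have N: "?N \<in> null_sets lborel" by (rule null_sets.Un[OF null_sets.Un[OF b c] m0])
    have S: "sym_diff C (cball b 1 \<union> cball c 1) \<in> null_sets lborel"
      by (rule null_sets_subset[OF N]) (use bor PC cover in auto)
    moreover have "ball b 1 \<inter> ball c 1 = {}"
    proof (rule ccontr)
      let ?U = "ball b 1 \<inter> ball c 1"
      assume ne: "?U \<noteq> {}"
      have U0: "0 < emeasure lborel ?U"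
        using ne open_Int[OF open_ball open_ball] by (intro emeasure_open_pos) auto
      have CU: "C \<subseteq> cball b 1 \<union> (cball c 1 - ?U) \<union> sym_diff C (cball b 1 \<union> cball c 1)"
        by auto
      have "emeasure lborel C \<le> emeasure lborel (cball b 1 \<union> (cball c 1 - ?U) \<union> sym_diff C (cball b 1 \<union> cball c 1))"
        by (rule emeasure_mono[OF CU]) (use bor in auto)
      also have "\<dots> = emeasure lborel (cball b 1 \<union> (cball c 1 - ?U))"
        using S by (intro emeasure_Un_null_set) auto
      also have "\<dots> \<le> emeasure lborel (cball b 1) + emeasure lborel (cball c 1 - ?U)"
        by (intro emeasure_subadditive) auto
      finally have "ennreal (2 * pi) \<le> ennreal pi + emeasure lborel (cball c 1 - ?U)"
        by (simp add: area emeasure_unit_ball)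
      moreover have "emeasure lborel (cball c 1 - ?U) \<le> ennreal pi"
        unfolding emeasure_unit_ball[of c, symmetric] by (rule emeasure_mono) auto
      ultimately have full: "emeasure lborel (cball c 1 - ?U) = ennreal pi"
        using add_pi_bounds_tight by blast
      have "?U \<subseteq> cball c 1" by auto
      then have "emeasure lborel (cball c 1 - ?U) + emeasure lborel ?U = ennreal pi"
        unfolding emeasure_unit_ball[of c, symmetric] by (rule emeasure_Diff_plus) auto
      then have "ennreal pi + emeasure lborel ?U = ennreal pi + 0" unfolding full by simp
      then have "emeasure lborel ?U = 0" by (rule ennreal_add_left_cancel[THEN iffD1, THEN disjE]) auto
      then show False using U0 by simp
    qed
    ultimately show ?thesis by blast
  qed
qed

theorem triangle_free_area:
  fixes C :: "(real^2) set"
  assumes C: "compact C" and tf: "triangle_free C"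
  shows triangle_free_area_le: "emeasure lborel C \<le> ennreal (2 * pi)"
    and triangle_free_area_eq: "emeasure lborel C = ennreal (2 * pi) \<Longrightarrow>
      \<exists>b c. sym_diff C (cball b 1 \<union> cball c 1) \<in> null_sets lborel \<and> ball b 1 \<inter> ball c 1 = {}"
proof -
  have *: "emeasure lborel C \<le> ennreal (2 * pi) \<and> (emeasure lborel C = ennreal (2 * pi) \<longrightarrow>
      (\<exists>b c. sym_diff C (cball b 1 \<union> cball c 1) \<in> null_sets lborel \<and> ball b 1 \<inter> ball c 1 = {}))"
  proof (cases "\<exists>p\<in>C. \<exists>q\<in>C. 4 \<le> dist p q")
    case True
    then show ?thesis using triangle_free_area_far[OF C tf] by blast
  next
    case False
    then have "emeasure lborel C < ennreal (2 * pi)"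
      by (intro triangle_free_area_less_near[OF C tf]) (force simp: not_le)
    then show ?thesis by auto
  qed
  show "emeasure lborel C \<le> ennreal (2 * pi)" using * by blast
  show "emeasure lborel C = ennreal (2 * pi) \<Longrightarrow>
      \<exists>b c. sym_diff C (cball b 1 \<union> cball c 1) \<in> null_sets lborel \<and> ball b 1 \<inter> ball c 1 = {}" using * by blast
qed

lemma triangle_free_closure:
  assumes "triangle_free A" shows "triangle_free (closure A)"
  unfolding triangle_free_def
proof (intro ballI, rule ccontr)
  fix p q r assume pqr: "p \<in> closure A" "q \<in> closure A" "r \<in> closure A"
    and "\<not> (dist p q \<le> 2 \<or> dist p r \<le> 2 \<or> dist q r \<le> 2)"
  then have far: "2 < dist p q" "2 < dist p r" "2 < dist q r" by auto
  define e where "e = (min (dist p q) (min (dist p r) (dist q r)) - 2) / 2"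
  have e: "0 < e" "2 * e \<le> dist p q - 2" "2 * e \<le> dist p r - 2" "2 * e \<le> dist q r - 2"
    using far by (auto simp: e_def)
  obtain p' q' r' where a: "p' \<in> A" "q' \<in> A" "r' \<in> A" "dist p' p < e" "dist q' q < e" "dist r' r < e"
    using pqr e(1) unfolding closure_approachable by metis
  have tri: "2 < dist x' y'" if "dist x' x < e" "dist y' y < e" "2 * e \<le> dist x y - 2" for x x' y y' :: 'a
  proof -
    have "dist x y \<le> dist x x' + dist x' y' + dist y' y"
      by (meson add_mono dist_triangle order_refl order_trans)
    then show ?thesis using that by (simp add: dist_commute)
  qed
  have "2 < dist p' q'" "2 < dist p' r'" "2 < dist q' r'"
    using tri a(4-6) e(2-4) by blast+
  then show False using assms a(1-3) unfolding triangle_free_def by (meson not_le)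
qed

lemma bounded_if_dist_le:
  assumes "\<And>x y. x \<in> S \<Longrightarrow> y \<in> S \<Longrightarrow> dist x y \<le> r"
  shows "bounded S"
proof (cases "S = {}")
  case False
  then obtain x where "x \<in> S" by blast
  then have "S \<subseteq> cball x r" using assms by auto
  then show ?thesis using bounded_cball bounded_subset by blast
qed simp

lemma triangle_free_bounded:
  assumes "triangle_free A" shows "bounded A"
proof (cases "\<exists>p\<in>A. \<exists>q\<in>A. 2 < dist p q")
  case True
  then obtain p q where pq: "p \<in> A" "q \<in> A" "2 < dist p q" by blast
  have "A \<subseteq> cball p 2 \<union> cball q 2"
    using triangle_freeD[OF assms pq(1,2) _ pq(3)] by (force simp: not_le)
  then show ?thesis by (meson bounded_Un bounded_cball bounded_subset)
next
  case False
  then show ?thesis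
    by (intro bounded_if_dist_le[of A 2]) (force simp: not_less)
qed

lemma area_le_of_dist_le:
  fixes S :: "(real^2) set"
  assumes "\<And>x y. x \<in> S \<Longrightarrow> y \<in> S \<Longrightarrow> dist x y \<le> 2"
  shows "emeasure lborel S \<le> ennreal pi"
proof -
  have "bounded S" using assms by (rule bounded_if_dist_le)
  then have c: "compact (closure S)" by simp
  have "emeasure lborel S \<le> emeasure lborel (closure S)"
    by (intro emeasure_mono closure_subset) auto
  also have "\<dots> \<le> ennreal pi"
    by (rule isodiametric_unit[OF c dist_closure_le[OF assms]])
  finally show ?thesis .
qed


section \<open>The edges of the large-distance graph\<close>

definition large_pairs :: "(real^2) set \<Rightarrow> ((real^2) \<times> (real^2)) set" where
  "large_pairs S = {(p, q). p \<in> S \<and> q \<in> S \<and> 2 < dist p q}"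

lemma large_pairs_eq_edges: "large_distance_edges = large_pairs"
  by (simp add: fun_eq_iff large_distance_edges_def large_pairs_def dist_norm)

lemma K3_free_iff_triangle_free: "large_distance_K3_free A \<longleftrightarrow> triangle_free A"
  unfolding large_distance_K3_free_def triangle_free_def dist_norm by (auto simp: not_less)

lemma large_pairs_borel:
  assumes "S \<in> sets borel" shows "large_pairs S \<in> sets borel"
proof -
  have "large_pairs S = (S \<times> S) \<inter> {z. 2 < dist (fst z) (snd z)}"
    by (auto simp: large_pairs_def)
  moreover have "open {z :: (real^2) \<times> (real^2). 2 < dist (fst z) (snd z)}"
    by (intro open_Collect_less continuous_intros)
  ultimately show ?thesis using borel_Times[OF assms assms] by simp
qed

text \<open>
  The points far from a given point of \<open>S\<close> are pairwise close, so every fibre over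
  \<open>S\<close> has area at most \<open>pi\<close>.
\<close>
lemma emeasure_large_pairs_le:
  assumes S: "S \<in> sets borel" and tf: "triangle_free S"
  shows "emeasure lborel (large_pairs S) \<le> ennreal pi * emeasure lborel S"
proof -
  have L: "large_pairs S \<in> sets (lborel \<Otimes>\<^sub>M lborel)"
    unfolding lborel_prod using large_pairs_borel[OF S] by simp
  have fibre: "emeasure lborel (Pair p -` large_pairs S) \<le> ennreal pi * indicator S p" for p
  proof (cases "p \<in> S")
    case True
    have "emeasure lborel (Pair p -` large_pairs S) \<le> ennreal pi"
      by (rule area_le_of_dist_le) (use triangle_freeD[OF tf True] in \<open>auto simp: large_pairs_def\<close>)
    then show ?thesis using True by simp
  next
    case False
    then have "Pair p -` large_pairs S = {}" by (auto simp: large_pairs_def)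
    then show ?thesis by simp
  qed
  have "emeasure (lborel \<Otimes>\<^sub>M lborel) (large_pairs S) = (\<integral>\<^sup>+p. emeasure lborel (Pair p -` large_pairs S) \<partial>lborel)"
    by (rule lborel.emeasure_pair_measure_alt[OF L])
  also have "\<dots> \<le> (\<integral>\<^sup>+p. ennreal pi * indicator S p \<partial>lborel)"
    by (rule nn_integral_mono) (rule fibre)
  also have "\<dots> = ennreal pi * emeasure lborel S"
    using S by (subst nn_integral_cmult_indicator) auto
  finally show ?thesis unfolding lborel_prod .
qed

lemma null_strips:
  assumes "N \<in> null_sets (lborel :: (real^2) measure)"
  shows "(N \<times> UNIV) \<union> (UNIV \<times> N) \<in> null_sets (lborel :: ((real^2) \<times> (real^2)) measure)"
proof -
  have N: "N \<in> sets lborel" "emeasure lborel N = 0" using assms by auto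
  have "N \<times> UNIV \<in> null_sets (lborel \<Otimes>\<^sub>M (lborel :: (real^2) measure))"
    using N by (intro null_setsI) (auto simp: lborel.emeasure_pair_measure_Times)
  moreover have "UNIV \<times> N \<in> null_sets ((lborel :: (real^2) measure) \<Otimes>\<^sub>M lborel)"
    using N by (intro null_setsI) (auto simp: lborel.emeasure_pair_measure_Times)
  ultimately show ?thesis unfolding lborel_prod by (rule null_sets.Un)
qed

lemma emeasure_lebesgue_le_off_null:
  fixes E :: "'a::euclidean_space set"
  assumes "E \<subseteq> D \<union> N" "D \<in> sets borel" "N \<in> null_sets lborel"
  shows "emeasure lebesgue E \<le> emeasure lborel D"
proof -
  have "N \<in> sets borel" using assms(3) by auto
  have "emeasure lebesgue E \<le> emeasure lebesgue (D \<union> N)"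
    by (rule emeasure_mono[OF assms(1)]) (use assms(2) \<open>N \<in> sets borel\<close> in auto)
  also have "\<dots> = emeasure lborel (D \<union> N)" using assms(2) \<open>N \<in> sets borel\<close> by simp
  also have "\<dots> = emeasure lborel D" using assms(2,3) by (intro emeasure_Un_null_set) auto
  finally show ?thesis .
qed

lemma lebesgue_large_pairs_le:
  assumes A: "A \<in> sets lebesgue" and tf: "triangle_free A"
  shows "emeasure lebesgue (large_pairs A) \<le> ennreal pi * emeasure lebesgue A"
proof -
  obtain S N N' where SN: "S \<in> sets lborel" "N' \<in> null_sets lborel" "N \<subseteq> N'" "A = S \<union> N"
    using A by (auto elim: sets_completionE)
  have "triangle_free S" using tf SN(4) unfolding triangle_free_def by blast
  then have le: "emeasure lborel (large_pairs S) \<le> ennreal pi * emeasure lborel S"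
    using SN(1) by (intro emeasure_large_pairs_le) auto
  have L: "large_pairs S \<in> sets borel" using SN(1) by (intro large_pairs_borel) simp
  have "emeasure lebesgue (large_pairs A) \<le> emeasure lborel (large_pairs S)"
    by (rule emeasure_lebesgue_le_off_null[OF _ L null_strips[OF SN(2)]])
       (use SN in \<open>auto simp: large_pairs_def\<close>)
  moreover have "emeasure lborel S \<le> emeasure lebesgue A"
  proof -
    have "emeasure lborel S = emeasure lebesgue S" using SN(1) by simp
    also have "\<dots> \<le> emeasure lebesgue A" by (rule emeasure_mono) (use A SN in auto)
    finally show ?thesis .
  qed
  ultimately show ?thesis using le by (meson mult_left_mono order_trans zero_le)
qed

text \<open>
  Up to null sets, an edge joins the two balls. If these contained points at distance less than 2,
  there would be open sets \<open>U\<close> and \<open>V\<close> in them without edges from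
  \<open>U\<close> to \<open>V\<close>, and the measure of the edges would fall short of
  \<open>2 * pi\<^sup>2\<close> by the positive measure of \<open>U \<times> V\<close>.
\<close>
lemma two_balls_edges_dist:
  fixes A :: "(real^2) set"
  assumes null: "sym_diff A (cball b 1 \<union> cball c 1) \<in> null_sets lebesgue"
    and full: "ennreal (2 * pi\<^sup>2) \<le> emeasure lebesgue (large_pairs A)"
  shows "2 \<le> setdist (cball b 1) (cball c 1)"
proof (rule ccontr)
  let ?B = "cball b 1" and ?C = "cball c 1"
  assume "\<not> ?thesis"
  moreover have "2 \<le> setdist ?B ?C" if "\<forall>x\<in>?B. \<forall>y\<in>?C. 2 \<le> dist x y"
    by (rule le_setdistI) (use that in auto)
  ultimately obtain x y where xy: "x \<in> ?B" "y \<in> ?C" "dist x y < 2" by (meson not_le)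
  \<comment> \<open>Both points will be moved by less than \<open>2 * e\<close>, which the gap \<open>2 - dist x y\<close> allows.\<close>
  define e where "e = (2 - dist x y) / 4"
  have e: "0 < e" using xy by (simp add: e_def)
  have "x \<in> closure (ball b 1)" "y \<in> closure (ball c 1)" using xy by simp_all
  then obtain x' y' where x'y': "x' \<in> ball b 1" "dist x' x < e" "y' \<in> ball c 1" "dist y' y < e"
    using e unfolding closure_approachable by metis
  let ?U = "ball b 1 \<inter> ball x' e" and ?V = "ball c 1 \<inter> ball y' e"
  have close: "dist p q \<le> 2" if "p \<in> ?U" "q \<in> ?V" for p q
  proof -
    have "dist p q \<le> dist p x' + (dist x' x + (dist x y + (dist y y' + dist y' q)))"
      by (meson add_left_mono dist_triangle order_trans)
    then show ?thesis using that x'y' by (simp add: dist_commute e_def)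
  qed
  have U0: "0 < emeasure lborel ?U" "0 < emeasure lborel ?V"
    using x'y' e by (intro emeasure_open_pos; auto)+
  obtain N where N: "N \<in> null_sets lborel" "sym_diff A (?B \<union> ?C) \<subseteq> N"
    using null unfolding null_sets_completion_iff2 by blast
  let ?D = "?B \<times> ?C - ?U \<times> ?V"
  have same: "dist p q \<le> 2" if "p \<in> cball z 1" "q \<in> cball z 1" for p q z :: "real^2"
    using dist_triangle[of p q z] that by (simp add: dist_commute)
  have "large_pairs A \<subseteq> (?D \<union> ?C \<times> ?B) \<union> ((N \<times> UNIV) \<union> (UNIV \<times> N))"
  proof
    fix z assume z: "z \<in> large_pairs A"
    obtain p q where pq: "z = (p, q)" "p \<in> A" "q \<in> A" "2 < dist p q"
      using z by (auto simp: large_pairs_def)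
    show "z \<in> (?D \<union> ?C \<times> ?B) \<union> ((N \<times> UNIV) \<union> (UNIV \<times> N))"
    proof (cases "p \<in> N \<or> q \<in> N")
      case False
      then have "p \<in> ?B \<union> ?C" "q \<in> ?B \<union> ?C" using N(2) pq by blast+
      then have "(p \<in> ?B \<and> q \<in> ?C) \<or> (p \<in> ?C \<and> q \<in> ?B)" using same pq(4) by (meson UnE not_le)
      moreover have "\<not> (p \<in> ?U \<and> q \<in> ?V)" using close pq(4) by (meson not_le)
      ultimately show ?thesis unfolding pq(1) by blast
    qed (use pq in auto)
  qed
  moreover have bor: "?U \<times> ?V \<in> sets borel" "?B \<times> ?C \<in> sets borel" "?C \<times> ?B \<in> sets borel"
    by (auto intro: borel_Times)
  ultimately have "emeasure lebesgue (large_pairs A) \<le> emeasure lborel (?D \<union> ?C \<times> ?B)"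
    by (intro emeasure_lebesgue_le_off_null[OF _ _ null_strips[OF N(1)]]) auto
  also have "\<dots> \<le> emeasure lborel ?D + emeasure lborel (?C \<times> ?B)"
    using bor by (intro emeasure_subadditive) auto
  finally have le: "ennreal (2 * pi\<^sup>2) \<le> emeasure lborel ?D + emeasure lborel (?C \<times> ?B)"
    using full by simp
  have times: "emeasure lborel (X \<times> Y) = emeasure lborel X * emeasure lborel Y"
    if "X \<in> sets borel" "Y \<in> sets borel" for X Y :: "(real^2) set"
    unfolding lborel_prod[symmetric] using that by (intro lborel.emeasure_pair_measure_Times) auto
  have BC: "emeasure lborel (?B \<times> ?C) = ennreal (pi\<^sup>2)" "emeasure lborel (?C \<times> ?B) = ennreal (pi\<^sup>2)"
    by (simp_all add: times emeasure_unit_ball power2_eq_square ennreal_mult)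
  have UV: "0 < emeasure lborel (?U \<times> ?V)" using U0 by (simp add: times ennreal_zero_less_mult_iff)
  have "?U \<times> ?V \<subseteq> ?B \<times> ?C" by auto
  then have sum: "emeasure lborel ?D + emeasure lborel (?U \<times> ?V) = ennreal (pi\<^sup>2)"
    unfolding BC(1)[symmetric] by (rule emeasure_Diff_plus) (use bor in auto)
  have "emeasure lborel ?D \<le> ennreal (pi\<^sup>2)" unfolding sum[symmetric] by simp
  then obtain d where d: "emeasure lborel ?D = ennreal d" "0 \<le> d"
    by (metis ennreal_cases ennreal_less_top leD)
  have "emeasure lborel (?U \<times> ?V) \<le> ennreal (pi\<^sup>2)" unfolding sum[symmetric] by simp
  then obtain v where v: "emeasure lborel (?U \<times> ?V) = ennreal v" "0 \<le> v"
    by (metis ennreal_cases ennreal_less_top leD)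
  have "d + v = pi\<^sup>2" using sum d v by (simp flip: ennreal_plus)
  moreover have "2 * pi\<^sup>2 \<le> d + pi\<^sup>2" using le d BC by (simp flip: ennreal_plus)
  moreover have "0 < v" using UV v by (simp add: ennreal_less_zero_iff)
  ultimately show False by simp
qed

theorem theorem1p7:
  fixes A :: "(real^2) set"
  assumes "A \<in> sets lebesgue"
    and "large_distance_K3_free A"
  shows "emeasure lebesgue A \<le> ennreal (2 * pi)
    \<and> large_distance_edge_count A \<le> ennreal (pi\<^sup>2)
    \<and> (emeasure lebesgue A = ennreal (2 * pi) \<longrightarrow>
         (\<exists>B C. is_unit_ball B \<and> is_unit_ball C \<and> non_overlapping B C \<and>
            equal_up_to_null A (B \<union> C)))
    \<and> (large_distance_edge_count A = ennreal (pi\<^sup>2) \<longrightarrow>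
         (\<exists>B C. is_unit_ball B \<and> is_unit_ball C \<and> B \<inter> C = {} \<and> setdist B C \<ge> 2 \<and>
            equal_up_to_null A (B \<union> C)))"
proof -
  note A = assms(1)
  have tf: "triangle_free A" using assms(2) by (simp add: K3_free_iff_triangle_free)
  let ?K = "closure A"
  have K: "compact ?K" using triangle_free_bounded[OF tf] by simp
  have tfK: "triangle_free ?K" by (rule triangle_free_closure[OF tf])
  have AK: "emeasure lebesgue A \<le> emeasure lborel ?K"
    using emeasure_mono[OF closure_subset[of A], of lebesgue] by simp
  then have area: "emeasure lebesgue A \<le> ennreal (2 * pi)"
    using triangle_free_area_le[OF K tfK] by (rule order_trans)
  have balls: "\<exists>b c. sym_diff A (cball b 1 \<union> cball c 1) \<in> null_sets lebesgue \<and> ball b 1 \<inter> ball c 1 = {}"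
    if eq: "emeasure lebesgue A = ennreal (2 * pi)"
  proof -
    have K2: "emeasure lborel ?K = ennreal (2 * pi)"
      using AK triangle_free_area_le[OF K tfK] unfolding eq by (rule antisym[rotated])
    obtain b c where bc: "sym_diff ?K (cball b 1 \<union> cball c 1) \<in> null_sets lborel" "ball b 1 \<inter> ball c 1 = {}"
      using triangle_free_area_eq[OF K tfK K2] by blast
    have "emeasure lebesgue (?K - A) = emeasure lebesgue ?K - emeasure lebesgue A"
      using A eq by (intro emeasure_Diff closure_subset) auto
    then have "?K - A \<in> null_sets lebesgue" using A eq K2 by (intro null_setsI) auto
    then have N: "sym_diff ?K (cball b 1 \<union> cball c 1) \<union> (?K - A) \<in> null_sets lebesgue"
      using bc(1) null_sets_completionI by blast
    have "sym_diff A (cball b 1 \<union> cball c 1) \<in> null_sets lebesgue"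
    proof (rule null_sets_subset[OF N])
      show "sym_diff A (cball b 1 \<union> cball c 1) \<in> sets lebesgue"
        using A by (intro sets.Un sets.Diff) auto
    qed (use closure_subset[of A] in auto)
    then show ?thesis using bc(2) by blast
  qed
  have edges: "emeasure lebesgue (large_pairs A) \<le> ennreal pi * emeasure lebesgue A"
    by (rule lebesgue_large_pairs_le[OF A tf])
  obtain a where a: "emeasure lebesgue A = ennreal a" "0 \<le> a" "a \<le> 2 * pi"
    using area by (cases "emeasure lebesgue A") (auto simp: top_unique)
  have edges': "emeasure lebesgue (large_pairs A) \<le> ennreal (pi * a)"
    using edges a by (simp add: ennreal_mult)
  obtain g where g: "emeasure lebesgue (large_pairs A) = ennreal g" "0 \<le> g" "g \<le> pi * a"
    using edges' a(2) by (cases "emeasure lebesgue (large_pairs A)") (auto simp: top_unique)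
  have half: "large_distance_edge_count A = ennreal (g / 2)"
  proof -
    have "(1 / 2 :: ennreal) = ennreal (1 / 2)" using divide_ennreal[of 1 2] by simp
    then have "large_distance_edge_count A = ennreal (1 / 2) * ennreal g"
      unfolding large_distance_edge_count_def large_pairs_eq_edges g(1) by (rule arg_cong)
    also have "\<dots> = ennreal (1 / 2 * g)" using g(2) by (intro ennreal_mult[symmetric]) auto
    finally show ?thesis by simp
  qed
  have pa: "pi * a \<le> 2 * pi\<^sup>2" using a(3) by (simp add: power2_eq_square)
  have "large_distance_edge_count A \<le> ennreal (pi\<^sup>2)"
    unfolding half using g pa by (intro ennreal_leI) simp
  moreover have "\<exists>B C. is_unit_ball B \<and> is_unit_ball C \<and> non_overlapping B C \<and> equal_up_to_null A (B \<union> C)"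
    if eq: "emeasure lebesgue A = ennreal (2 * pi)"
  proof -
    obtain b c where bc: "sym_diff A (cball b 1 \<union> cball c 1) \<in> null_sets lebesgue" "ball b 1 \<inter> ball c 1 = {}"
      using balls[OF eq] by blast
    have "non_overlapping (cball b 1) (cball c 1)"
      using bc(2) by (simp add: non_overlapping_def)
    then show ?thesis using bc(1) unfolding is_unit_ball_def equal_up_to_null_def by blast
  qed
  moreover have "\<exists>B C. is_unit_ball B \<and> is_unit_ball C \<and> B \<inter> C = {} \<and> setdist B C \<ge> 2 \<and> equal_up_to_null A (B \<union> C)"
    if cnt: "large_distance_edge_count A = ennreal (pi\<^sup>2)"
  proof -
    have g2: "g = 2 * pi\<^sup>2" using cnt g(2) unfolding half by (simp add: ennreal_inj)
    then have "2 * pi\<^sup>2 \<le> pi * a" using g(3) by simp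
    then have "2 * pi \<le> a" by (simp add: power2_eq_square)
    then have "emeasure lebesgue A = ennreal (2 * pi)" using a by simp
    from balls[OF this] obtain b c where
      bc: "sym_diff A (cball b 1 \<union> cball c 1) \<in> null_sets lebesgue" by blast
    have d: "2 \<le> setdist (cball b 1) (cball c 1)"
      by (rule two_balls_edges_dist[OF bc]) (simp add: g g2)
    have "cball b 1 \<inter> cball c 1 = {}"
    proof (rule ccontr)
      assume "\<not> ?thesis"
      then obtain z where "z \<in> cball b 1" "z \<in> cball c 1" by blast
      then have "setdist (cball b 1) (cball c 1) \<le> dist z z" by (rule setdist_le_dist)
      then show False using d by simp
    qed
    then show ?thesis
      using bc d unfolding is_unit_ball_def equal_up_to_null_def by blast
  qed
  ultimately show ?thesis using area by blast
qed

end
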